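(* For every positive integer $n$, the inverse Kazhdan--Lusztig polynomial $Q_{T_n}(t)$ of the thagomizer matroid $T_n$ is log-concave.
   Context: The thagomizer matroid $T_n$ is the graphic matroid of $K_{1,1,n}$ (vertices $A,B,1,\dots,n$, edges $AB,Aj,Bj$ for $1\le j\le n$). For a loopless matroid $\mathrm M$ (lattice of flats $\mathcal L(\mathrm M)$, characteristic polynomial $\chi$, restriction $\mathrm M|_F$, contraction $\mathrm M/F$), the inverse Kazhdan--Lusztig polynomial $Q_{\mathrm M}(t)\in\mathbb Z[t]$ is the unique polynomial with $Q_{\mathrm M}=1$ if $\operatorname{rk}\mathrm M=0$, $\deg Q_{\mathrm M}<\tfrac12\operatorname{rk}\mathrm M$ if $\operatorname{rk}\mathrm M>0$, and $t^{\operatorname{rk}\mathrm M}(-1)^{\operatorname{rk}\mathrm M}Q_{\mathrm M}(t^{-1})=\sum_{F\in\mathcal L(\mathrm M)}(-1)^{\operatorname{rk}\mathrm M|_F}Q_{\mathrm M|_F}(t)\,t^{\operatorname{rk}\mathrm M/F}\chi_{\mathrm M/F}(t^{-1})$. A polynomial $\sum_{i=0}^m a_it^i$ is log-concave if $a_i^2\ge a_{i-1}a_{i+1}$ for all $1\le i\le m-1$. *)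

theory Defs
  imports "HOL-Computational_Algebra.Polynomial"
begin

record 'a matroid =
  ground :: "'a set"
  indeps :: "'a set set"

definition is_matroid :: "'a matroid \<Rightarrow> bool" where
  "is_matroid M \<longleftrightarrow>
     finite (ground M) \<and> indeps M \<subseteq> Pow (ground M) \<and> {} \<in> indeps M \<and>
     (\<forall>I\<in>indeps M. \<forall>J. J \<subseteq> I \<longrightarrow> J \<in> indeps M) \<and>
     (\<forall>I\<in>indeps M. \<forall>J\<in>indeps M. card I < card J \<longrightarrow> (\<exists>e\<in>J - I. insert e I \<in> indeps M))"

definition loopless :: "'a matroid \<Rightarrow> bool" where
  "loopless M \<longleftrightarrow> (\<forall>e\<in>ground M. {e} \<in> indeps M)"

definition rank_of :: "'a matroid \<Rightarrow> 'a set \<Rightarrow> nat" where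
  "rank_of M X = Max (card ` {I \<in> indeps M. I \<subseteq> X})"

definition rk :: "'a matroid \<Rightarrow> nat" where
  "rk M = rank_of M (ground M)"

definition flats :: "'a matroid \<Rightarrow> 'a set set" where
  "flats M = {F. F \<subseteq> ground M \<and> (\<forall>e\<in>ground M - F. rank_of M F < rank_of M (insert e F))}"

definition restriction :: "'a matroid \<Rightarrow> 'a set \<Rightarrow> 'a matroid" where
  "restriction M X = \<lparr>ground = ground M \<inter> X, indeps = {I \<in> indeps M. I \<subseteq> X}\<rparr>"

definition contraction :: "'a matroid \<Rightarrow> 'a set \<Rightarrow> 'a matroid" where
  "contraction M X =
     \<lparr>ground = ground M - X,
      indeps = {I. I \<subseteq> ground M - X \<and> rank_of M (I \<union> X) = card I + rank_of M X}\<rparr>"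

text \<open>The Moebius function of a family \<open>L\<close> of finite sets, ordered by inclusion.\<close>

function moebius :: "'a set set \<Rightarrow> 'a set \<Rightarrow> 'a set \<Rightarrow> int" where
  "moebius L X Y =
     (if X = Y then 1
      else if finite Y \<and> X \<subset> Y then - (\<Sum>Z\<in>{Z \<in> L. X \<subseteq> Z \<and> Z \<subset> Y}. moebius L X Z)
      else 0)"
  by auto
termination
  by (relation "measure (\<lambda>(L, X, Y). card Y)") (auto intro: psubset_card_mono)

declare moebius.simps [simp del]

text \<open>In a loopless matroid the least flat is \<open>{}\<close>.  The contraction of a matroid by a flat is
  loopless, so this is the only case in which the characteristic polynomial is used.\<close>

definition char_poly :: "'a matroid \<Rightarrow> int poly" where
  "char_poly M = (\<Sum>F\<in>flats M. monom (moebius (flats M) {} F) (rk M - rank_of M F))"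

text \<open>\<open>t ^ d * p (1 / t)\<close>, for \<open>degree p \<le> d\<close>.  This differs from \<open>reflect_poly p\<close> when
  \<open>degree p < d\<close>.\<close>

definition reverse_poly :: "nat \<Rightarrow> 'a::comm_monoid_add poly \<Rightarrow> 'a poly" where
  "reverse_poly d p = (\<Sum>i\<le>d. monom (coeff p i) (d - i))"

definition inverse_KL_conditions :: "('a matroid \<Rightarrow> int poly) \<Rightarrow> 'a matroid \<Rightarrow> bool" where
  "inverse_KL_conditions Q M \<longleftrightarrow>
     (rk M = 0 \<longrightarrow> Q M = 1) \<and>
     (rk M > 0 \<longrightarrow> 2 * degree (Q M) < rk M) \<and>
     (-1) ^ rk M * reverse_poly (rk M) (Q M) =
       (\<Sum>F\<in>flats M. (-1) ^ rk (restriction M F) * Q (restriction M F) *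
          reverse_poly (rk (contraction M F)) (char_poly (contraction M F)))"

text \<open>The conditions determine the polynomials by recursion over restrictions to flats.  Since
  flats of \<open>restriction M F\<close> are flats of \<open>M\<close> and \<open>M\<close> is its own restriction to the flat
  \<open>ground M\<close>, imposing the conditions on the matroids \<open>restriction M F\<close> pins down \<open>Q M\<close>.\<close>

definition inverse_KL :: "'a matroid \<Rightarrow> int poly" where
  "inverse_KL M =
     (THE q. \<exists>Q. (\<forall>F\<in>flats M. inverse_KL_conditions Q (restriction M F)) \<and> q = Q M)"

definition log_concave :: "'a::linordered_idom poly \<Rightarrow> bool" where
  "log_concave p \<longleftrightarrow>
     (\<forall>i. 1 \<le> i \<and> i + 1 \<le> degree p \<longrightarrow> coeff p i ^ 2 \<ge> coeff p (i - 1) * coeff p (i + 1))"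

text \<open>A simple graph is given by its set of edges, which are two-element sets of vertices.\<close>

definition is_cycle :: "'v set set \<Rightarrow> 'v list \<Rightarrow> bool" where
  "is_cycle E vs \<longleftrightarrow>
     length vs \<ge> 3 \<and> distinct vs \<and>
     successively (\<lambda>u v. {u, v} \<in> E) vs \<and> {last vs, hd vs} \<in> E"

definition graphic_matroid :: "'v set set \<Rightarrow> 'v set matroid" where
  "graphic_matroid E = \<lparr>ground = E, indeps = {I. I \<subseteq> E \<and> (\<nexists>vs. is_cycle I vs)}\<rparr>"

datatype thag_vertex = VertA | VertB | Spike nat

definition thagomizer_edges :: "nat \<Rightarrow> thag_vertex set set" where
  "thagomizer_edges n =
     {{VertA, VertB}} \<union> (\<lambda>j. {VertA, Spike j}) ` {1..n} \<union> (\<lambda>j. {VertB, Spike j}) ` {1..n}"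

definition thagomizer :: "nat \<Rightarrow> thag_vertex set matroid" where
  "thagomizer n = graphic_matroid (thagomizer_edges n)"

text \<open>\<open>thagomizer n\<close> is indeed a loopless matroid.\<close>

definition joined :: "'v set set \<Rightarrow> ('v \<times> 'v) set" where
  "joined I = {(u, v). {u, v} \<in> I}\<^sup>*"

lemma joined_refl: "(u, u) \<in> joined I"
  by (simp add: joined_def)

lemma joined_trans: "(u, v) \<in> joined I \<Longrightarrow> (v, w) \<in> joined I \<Longrightarrow> (u, w) \<in> joined I"
  unfolding joined_def by (rule rtrancl_trans)

lemma joined_sym: "(u, v) \<in> joined I \<Longrightarrow> (v, u) \<in> joined I"
proof -
  have "sym {(u, v). {u, v} \<in> I}"
    by (auto simp: sym_def insert_commute)
  then show "(u, v) \<in> joined I \<Longrightarrow> (v, u) \<in> joined I"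
    unfolding joined_def by (meson sym_rtrancl symD)
qed

lemma joined_edge: "{u, v} \<in> I \<Longrightarrow> (u, v) \<in> joined I"
  by (auto simp: joined_def)

lemma joined_mono: "I \<subseteq> J \<Longrightarrow> joined I \<subseteq> joined J"
  unfolding joined_def by (rule rtrancl_mono) auto

lemma joined_least:
  assumes "\<And>u v. {u, v} \<in> J \<Longrightarrow> (u, v) \<in> joined I"
  shows "joined J \<subseteq> joined I"
proof -
  have "{(u, v). {u, v} \<in> J}\<^sup>* \<subseteq> ({(u, v). {u, v} \<in> I}\<^sup>*)\<^sup>*"
    by (rule rtrancl_mono) (use assms in \<open>auto simp: joined_def\<close>)
  then show ?thesis
    by (simp add: joined_def)
qed

lemma joined_path:
  assumes "(u, v) \<in> joined I"
  shows "\<exists>vs. vs \<noteq> [] \<and> hd vs = u \<and> last vs = v \<and> distinct vs \<and>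
           successively (\<lambda>x y. {x, y} \<in> I) vs"
  using assms unfolding joined_def
proof (induction rule: rtrancl_induct)
  case base
  show ?case by (rule exI[of _ "[u]"]) simp
next
  case (step y z)
  then obtain vs where vs: "vs \<noteq> []" "hd vs = u" "last vs = y" "distinct vs"
    "successively (\<lambda>x y. {x, y} \<in> I) vs" by blast
  show ?case
  proof (cases "z \<in> set vs")
    case True
    then obtain ps qs where "vs = ps @ z # qs" by (meson split_list)
    with vs show ?thesis
      by (intro exI[of _ "ps @ [z]"])
         (cases ps; auto simp: successively_append_iff successively_Cons hd_append split: if_splits)
  next
    case False
    with vs step show ?thesis
      by (intro exI[of _ "vs @ [z]"]) (auto simp: successively_append_iff)
  qed
qed

lemma path_joined:
  assumes "vs \<noteq> []" "successively (\<lambda>x y. {x, y} \<in> I) vs"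
  shows "(hd vs, last vs) \<in> joined I"
  using assms
proof (induction vs)
  case (Cons a vs)
  then show ?case
    by (cases "vs = []") (auto simp: successively_Cons joined_refl intro: joined_trans joined_edge)
qed simp

lemma acyclic_insertD:
  assumes "\<nexists>vs. is_cycle (insert {u, v} I) vs" "u \<noteq> v" "{u, v} \<notin> I"
  shows "(u, v) \<notin> joined I"
proof
  assume "(u, v) \<in> joined I"
  then obtain vs where vs: "vs \<noteq> []" "hd vs = u" "last vs = v" "distinct vs"
    "successively (\<lambda>x y. {x, y} \<in> I) vs" using joined_path by metis
  have "length vs \<ge> 3"
  proof (rule ccontr)
    assume "\<not> length vs \<ge> 3"
    with vs(1) consider a where "vs = [a]" | a b where "vs = [a, b]"
      by (cases vs rule: remdups_adj.cases) (auto simp: Suc_le_eq not_le)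
    then show False using vs assms by cases auto
  qed
  moreover have "successively (\<lambda>x y. {x, y} \<in> insert {u, v} I) vs"
    using vs(5) by (rule successively_mono) auto
  ultimately have "is_cycle (insert {u, v} I) vs"
    using vs by (simp add: is_cycle_def insert_commute)
  with assms show False by blast
qed

lemma cycle_closing_joined:
  assumes "is_cycle (insert {u, v} I) vs" "{last vs, hd vs} = {u, v}"
  shows "(u, v) \<in> joined I"
proof -
  have vs: "length vs \<ge> 3" "distinct vs" "vs \<noteq> []"
    "successively (\<lambda>x y. {x, y} \<in> insert {u, v} I) vs"
    using assms(1) by (auto simp: is_cycle_def)
  have "successively (\<lambda>x y. {x, y} \<in> I) vs"
    unfolding successively_conv_nth
  proof (intro allI impI)
    fix i assume i: "Suc i < length vs"
    have "{vs ! i, vs ! Suc i} \<noteq> {last vs, hd vs}"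
      using i vs by (auto simp: doubleton_eq_iff hd_conv_nth last_conv_nth nth_eq_iff_index_eq)
    moreover have "{vs ! i, vs ! Suc i} \<in> insert {u, v} I"
      using vs(4) i by (simp add: successively_conv_nth)
    ultimately show "{vs ! i, vs ! Suc i} \<in> I"
      using assms(2) by auto
  qed
  then have "(hd vs, last vs) \<in> joined I"
    using vs by (intro path_joined)
  then show ?thesis
    using assms(2) joined_sym by (metis doubleton_eq_iff)
qed

lemma is_cycle_rotate:
  assumes "is_cycle E (ps @ qs)" "ps \<noteq> []" "qs \<noteq> []"
  shows "is_cycle E (qs @ ps)"
  using assms by (auto simp: is_cycle_def successively_append_iff)

lemma acyclic_insertI:
  assumes "\<nexists>vs. is_cycle I vs" "(u, v) \<notin> joined I"
  shows "\<nexists>vs. is_cycle (insert {u, v} I) vs"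
proof
  assume "\<exists>vs. is_cycle (insert {u, v} I) vs"
  then obtain vs where vs: "is_cycle (insert {u, v} I) vs" by blast
  show False
  proof (cases "{last vs, hd vs} = {u, v}")
    case True
    with vs assms show False using cycle_closing_joined by metis
  next
    case False
    then have "\<not> successively (\<lambda>x y. {x, y} \<in> I) vs"
      using vs assms(1) by (auto simp: is_cycle_def)
    then obtain i where i: "Suc i < length vs" "{vs ! i, vs ! Suc i} \<notin> I"
      by (auto simp: successively_conv_nth)
    then have e: "{vs ! i, vs ! Suc i} = {u, v}"
      using vs by (auto simp: is_cycle_def successively_conv_nth)
    have "is_cycle (insert {u, v} I) (drop (Suc i) vs @ take (Suc i) vs)"
    proof (rule is_cycle_rotate)
      show "is_cycle (insert {u, v} I) (take (Suc i) vs @ drop (Suc i) vs)"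
        using vs by simp
      show "take (Suc i) vs \<noteq> []" "drop (Suc i) vs \<noteq> []"
        using i(1) by auto
    qed
    moreover have "last (drop (Suc i) vs @ take (Suc i) vs) = vs ! i"
      "hd (drop (Suc i) vs @ take (Suc i) vs) = vs ! Suc i"
      using i(1) by (auto simp: take_Suc_conv_app_nth hd_append hd_drop_conv_nth last_append)
    ultimately show False
      using cycle_closing_joined e assms(2) by metis
  qed
qed

definition comp_of :: "'v set set \<Rightarrow> 'v \<Rightarrow> 'v set" where
  "comp_of I x = joined I `` {x}"

lemma comp_of_eq_iff: "comp_of I x = comp_of I y \<longleftrightarrow> (x, y) \<in> joined I"
  unfolding comp_of_def by (auto intro: joined_refl joined_sym joined_trans)

lemma joined_insert:
  "(x, y) \<in> joined (insert {u, v} I) \<longleftrightarrow>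
     (x, y) \<in> joined I \<or> (x, u) \<in> joined I \<and> (v, y) \<in> joined I \<or>
     (x, v) \<in> joined I \<and> (u, y) \<in> joined I" (is "?l \<longleftrightarrow> ?r x y")
proof
  assume ?l
  then show "?r x y"
    unfolding joined_def[of "insert {u, v} I"]
  proof (induction rule: rtrancl_induct)
    case base
    show ?case by (simp add: joined_refl)
  next
    case (step y z)
    from step.hyps consider "{y, z} \<in> I" | "y = u" "z = v" | "y = v" "z = u"
      by (auto simp: doubleton_eq_iff)
    then show ?case
      using step.IH by cases (metis joined_edge joined_trans joined_refl joined_sym)+
  qed
next
  let ?J = "insert {u, v} I"
  assume "?r x y"
  moreover have "joined I \<subseteq> joined ?J" by (rule joined_mono) auto
  moreover have "(u, v) \<in> joined ?J" "(v, u) \<in> joined ?J"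
    by (auto intro: joined_edge joined_sym)
  ultimately show ?l
    by (meson joined_trans subsetD)
qed

lemma card_comps_insert:
  assumes "finite V" "u \<in> V" "v \<in> V" "(u, v) \<notin> joined I"
  shows "Suc (card (comp_of (insert {u, v} I) ` V)) = card (comp_of I ` V)"
proof -
  let ?c = "comp_of I" and ?d = "comp_of (insert {u, v} I)"
  let ?W = "{x \<in> V. (x, u) \<notin> joined I \<and> (x, v) \<notin> joined I}"
  have d: "?d x = ?c x" if "x \<in> ?W" for x
    using that unfolding comp_of_def by (auto simp: joined_insert)
  have du: "?d x = ?d u" if "x \<in> V - ?W" for x
    using that unfolding comp_of_eq_iff
    by (auto simp: joined_insert joined_refl intro: joined_sym)
  have 1: "?d ` V = insert (?d u) (?c ` ?W)"
    using d du \<open>u \<in> V\<close> by (auto simp: image_iff) (metis (mono_tags, lifting) d)+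
  have 2: "?d u \<notin> ?c ` ?W"
  proof
    assume "?d u \<in> ?c ` ?W"
    then obtain x where x: "x \<in> ?W" "?d u = ?d x" using d by auto
    then show False
      unfolding comp_of_eq_iff joined_insert
      by (auto dest: joined_sym intro: joined_refl)
  qed
  have 3: "?c ` V = insert (?c u) (insert (?c v) (?c ` ?W))"
  proof -
    have "?c x \<in> insert (?c u) (insert (?c v) (?c ` ?W))" if "x \<in> V" for x
      using that by (cases "x \<in> ?W") (auto simp: comp_of_eq_iff)
    then show ?thesis using assms(2,3) by blast
  qed
  have 4: "?c u \<notin> insert (?c v) (?c ` ?W)" "?c v \<notin> ?c ` ?W"
    using assms(4) by (auto simp: comp_of_eq_iff dest: joined_sym)
  have "finite (?c ` ?W)" using assms(1) by simp
  with 1 2 3 4 show ?thesis by simp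
qed

lemma is_cycle_mono: "is_cycle I vs \<Longrightarrow> I \<subseteq> J \<Longrightarrow> is_cycle J vs"
  unfolding is_cycle_def by (auto elim: successively_mono)

lemma card_acyclic:
  assumes "finite V" "finite I" "\<nexists>vs. is_cycle I vs"
    "\<And>e. e \<in> I \<Longrightarrow> \<exists>u v. e = {u, v} \<and> u \<noteq> v \<and> u \<in> V \<and> v \<in> V"
  shows "card I + card (comp_of I ` V) = card V"
  using assms(2-)
proof (induction I)
  case empty
  have "comp_of {} = (\<lambda>x::'a. {x})"
    by (auto simp: comp_of_def joined_def)
  then show ?case by (simp add: card_image inj_on_def)
next
  case (insert e I)
  then obtain u v where e: "e = {u, v}" "u \<noteq> v" "u \<in> V" "v \<in> V" by blast
  have "\<nexists>vs. is_cycle I vs"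
    using insert.prems(1) is_cycle_mono by (metis subset_insertI)
  then have "card I + card (comp_of I ` V) = card V"
    using insert by blast
  moreover have "(u, v) \<notin> joined I"
    using acyclic_insertD insert e by metis
  ultimately show ?case
    using card_comps_insert[OF assms(1) e(3,4), of I] insert.hyps e(1) by simp
qed

lemma is_matroid_graphic_matroid:
  assumes "finite E" "\<And>e. e \<in> E \<Longrightarrow> \<exists>u v. e = {u, v} \<and> u \<noteq> v"
  shows "is_matroid (graphic_matroid E)"
proof -
  have exch: "\<exists>e\<in>J - I. insert e I \<subseteq> E \<and> (\<nexists>vs. is_cycle (insert e I) vs)"
    if I: "I \<subseteq> E" "\<nexists>vs. is_cycle I vs" and J: "J \<subseteq> E" "\<nexists>vs. is_cycle J vs"
      and lt: "card I < card J" for I J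
  proof (rule ccontr)
    assume no: "\<not> ?thesis"
    let ?V = "\<Union>E"
    have V: "finite ?V"
      using assms by (metis finite.emptyI finite.insertI finite_Union)
    have fin: "finite I" "finite J"
      using I J assms(1) finite_subset by auto
    have edge: "\<exists>u v. e = {u, v} \<and> u \<noteq> v \<and> u \<in> ?V \<and> v \<in> ?V" if "e \<in> E" for e
      using assms(2)[OF that] that by blast
    have cI: "card I + card (comp_of I ` ?V) = card ?V"
      by (rule card_acyclic[OF V fin(1) I(2)]) (use edge I in blast)
    have cJ: "card J + card (comp_of J ` ?V) = card ?V"
      by (rule card_acyclic[OF V fin(2) J(2)]) (use edge J in blast)
    have "joined J \<subseteq> joined I"
    proof (rule joined_least)
      fix u v assume uv: "{u, v} \<in> J"
      show "(u, v) \<in> joined I"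
      proof (cases "{u, v} \<in> I")
        case False
        with uv no I J show ?thesis
          using acyclic_insertI[OF I(2), of u v] by blast
      qed (rule joined_edge)
    qed
    then have "comp_of I x = comp_of I (SOME y. y \<in> ?V \<and> comp_of J y = comp_of J x)"
      if "x \<in> ?V" for x
      using someI[of "\<lambda>y. y \<in> ?V \<and> comp_of J y = comp_of J x" x] that
      unfolding comp_of_eq_iff using joined_refl joined_sym by (metis (no_types, lifting) subsetD)
    then have "comp_of I ` ?V =
        (\<lambda>C. comp_of I (SOME y. y \<in> ?V \<and> comp_of J y = C)) ` comp_of J ` ?V"
      unfolding image_image by (rule image_cong[OF refl])
    then have "card (comp_of I ` ?V) \<le> card (comp_of J ` ?V)"
      by (simp only: card_image_le finite_imageI V)
    with cI cJ lt show False by simp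
  qed
  have "\<not> is_cycle {} vs" for vs :: "'a list"
    by (cases vs; cases "tl vs") (auto simp: is_cycle_def)
  then have "{} \<in> indeps (graphic_matroid E)"
    by (simp add: graphic_matroid_def)
  moreover have "J \<in> indeps (graphic_matroid E)" if "I \<in> indeps (graphic_matroid E)" "J \<subseteq> I" for I J
  proof -
    have "J \<subseteq> E" using that by (auto simp: graphic_matroid_def)
    moreover have "\<not> is_cycle J vs" for vs
      using that is_cycle_mono[of J vs I] by (auto simp: graphic_matroid_def)
    ultimately show ?thesis by (simp add: graphic_matroid_def)
  qed
  moreover have "\<exists>e\<in>J - I. insert e I \<in> indeps (graphic_matroid E)"
    if "I \<in> indeps (graphic_matroid E)" "J \<in> indeps (graphic_matroid E)" "card I < card J" for I J
    using that exch[of I J] by (simp add: graphic_matroid_def)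
  moreover have "finite (ground (graphic_matroid E))"
    "indeps (graphic_matroid E) \<subseteq> Pow (ground (graphic_matroid E))"
    using assms(1) by (auto simp: graphic_matroid_def)
  ultimately show ?thesis
    unfolding is_matroid_def by blast
qed

lemma loopless_graphic_matroid: "loopless (graphic_matroid E)"
proof -
  have "\<not> is_cycle {e} vs" for e :: "'a set" and vs
  proof
    assume c: "is_cycle {e} vs"
    then have "length vs \<ge> 3" "distinct vs" "{vs ! 0, vs ! 1} = e" "{vs ! 1, vs ! 2} = e"
      by (auto simp: is_cycle_def successively_conv_nth numeral_2_eq_2)
    then have "vs ! 0 = vs ! 2"
      by (auto simp: doubleton_eq_iff)
    moreover have "0 < length vs" "2 < length vs"
      using \<open>length vs \<ge> 3\<close> by linarith+
    ultimately show False
      using nth_eq_iff_index_eq[OF \<open>distinct vs\<close>, of 0 2] by simp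
  qed
  then show ?thesis
    by (auto simp: loopless_def graphic_matroid_def)
qed

lemma is_matroid_thagomizer: "is_matroid (thagomizer n)"
  unfolding thagomizer_def
  by (rule is_matroid_graphic_matroid) (auto simp: thagomizer_edges_def)

lemma loopless_thagomizer: "loopless (thagomizer n)"
  by (simp add: thagomizer_def loopless_graphic_matroid)

end

theory Submission
  imports Defs
begin

text \<open>
  The restriction to a flat containing \<open>AB\<close> is a smaller thagomizer matroid, and all other flats are
  independent sets; so the recursion for \<open>Q\<close> only involves \<open>Q = 1\<close> (Boolean matroids) and the \<open>Q\<^sub>k\<close> of
  smaller thagomizers, and becomes
  \<open>t\<^sup>n\<^sup>+\<^sup>1 Q\<^sub>n(1/t) = (\<Sum>k. (n choose k) (t - 1)\<^sup>n\<^sup>-\<^sup>k Q\<^sub>k) + (t - 1) (1 + 2 t)\<^sup>n\<close>.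
  Substituting \<open>Q\<^sub>n = (\<Sum>k. (n choose k) H\<^sub>k)\<close> turns this into
  \<open>t\<^sup>k\<^sup>+\<^sup>1 H\<^sub>k(1/t) = H\<^sub>k - (1 - t) (1 + t)\<^sup>k\<close>, so that \<open>H\<^sub>k\<close> is the lower half of
  \<open>(1 - t) (1 + t)\<^sup>k\<close>. Hence \<open>(n + 1) [t\<^sup>i] Q\<^sub>n = (n + 1 choose i) S(n + 1 - i, i)\<close> with
  \<open>S(N, s) = (\<Sum>j. (N choose j) max 0 (j - s))\<close>. The Pascal recursion
  \<open>S(N + 1, s) = S(N, s) + S(N, s - 1)\<close> preserves log-concavity in \<open>s\<close>, and expanding
  \<open>S(N + 1, s - 1)\<close> and \<open>S(N, s)\<close> in the sequence \<open>S(N - 1, \<cdot>)\<close> gives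
  \<open>S(N, s)\<^sup>2 \<ge> S(N + 1, s - 1) S(N - 1, s + 1)\<close>.
\<close>

section \<open>Flats of restrictions and contractions\<close>

lemma matroid_finite_indep:
  assumes "is_matroid M" "I \<in> indeps M"
  shows "finite I" "I \<subseteq> ground M"
  using assms unfolding is_matroid_def by (auto intro: finite_subset)

lemma finite_indep_cards:
  assumes "is_matroid M"
  shows "finite (card ` {I \<in> indeps M. I \<subseteq> X})" "card ` {I \<in> indeps M. I \<subseteq> X} \<noteq> {}"
proof -
  have "finite (indeps M)"
    using assms unfolding is_matroid_def by (meson finite_Pow_iff finite_subset)
  then show "finite (card ` {I \<in> indeps M. I \<subseteq> X})" by simp
  have "{} \<in> indeps M" using assms unfolding is_matroid_def by blast
  then show "card ` {I \<in> indeps M. I \<subseteq> X} \<noteq> {}" by blast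
qed

lemma card_le_rank_of:
  assumes "is_matroid M" "I \<in> indeps M" "I \<subseteq> X"
  shows "card I \<le> rank_of M X"
  unfolding rank_of_def using assms finite_indep_cards[OF assms(1)] by (intro Max_ge) auto

lemma rank_of_basis:
  assumes "is_matroid M"
  obtains I where "I \<in> indeps M" "I \<subseteq> X" "card I = rank_of M X"
proof -
  have "rank_of M X \<in> card ` {I \<in> indeps M. I \<subseteq> X}"
    unfolding rank_of_def using finite_indep_cards[OF assms] by (rule Max_in)
  then show ?thesis using that by auto
qed

text \<open>As long as an independent set is smaller than a maximum independent subset of
  \<open>X\<close>, the exchange axiom supplies another element of \<open>X\<close>; the induction
  runs on the number of missing elements.\<close>

lemma rank_of_basis_extend:
  assumes "is_matroid M" "I \<in> indeps M" "I \<subseteq> X"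
  obtains J where "J \<in> indeps M" "I \<subseteq> J" "J \<subseteq> X" "card J = rank_of M X"
proof -
  have "\<exists>J. J \<in> indeps M \<and> I \<subseteq> J \<and> J \<subseteq> X \<and> card J = rank_of M X"
    using assms(2,3)
  proof (induction "rank_of M X - card I" arbitrary: I)
    case 0
    then show ?case using card_le_rank_of[OF assms(1), of I X] by (intro exI[of _ I]) auto
  next
    case (Suc k)
    obtain B where B: "B \<in> indeps M" "B \<subseteq> X" "card B = rank_of M X"
      using rank_of_basis[OF assms(1)] .
    have "card I < card B" using Suc.hyps(2) B(3) by linarith
    then obtain e where e: "e \<in> B - I" "insert e I \<in> indeps M"
      using assms(1) B(1) Suc.prems(1) unfolding is_matroid_def by metis
    moreover have "finite I" using matroid_finite_indep assms(1) Suc.prems(1) by blast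
    ultimately have "k = rank_of M X - card (insert e I)" "insert e I \<subseteq> X"
      using Suc B by auto
    with Suc.hyps(1) e show ?case by (metis insert_subset)
  qed
  then show ?thesis using that by blast
qed

lemma rank_of_mono:
  assumes "is_matroid M" "X \<subseteq> Y"
  shows "rank_of M X \<le> rank_of M Y"
proof -
  obtain I where "I \<in> indeps M" "I \<subseteq> X" "card I = rank_of M X"
    using rank_of_basis[OF assms(1)] .
  then show ?thesis using card_le_rank_of[OF assms(1), of I Y] assms(2) by auto
qed

text \<open>Monotonicity of closure, read contrapositively. A basis of \<open>X\<close> is extended
  to one of \<open>Y\<close> and then to one of \<open>insert e Y\<close>; the last must contain
  \<open>e\<close>, so the basis of \<open>X\<close> stays independent when \<open>e\<close> is
  added.\<close>

lemma rank_of_insert_less_mono: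
  assumes M: "is_matroid M" and "X \<subseteq> Y" and less: "rank_of M Y < rank_of M (insert e Y)"
  shows "rank_of M X < rank_of M (insert e X)"
proof -
  obtain I where I: "I \<in> indeps M" "I \<subseteq> X" "card I = rank_of M X"
    using rank_of_basis[OF M] .
  then obtain J where J: "J \<in> indeps M" "I \<subseteq> J" "J \<subseteq> Y" "card J = rank_of M Y"
    using rank_of_basis_extend[OF M, of I Y] \<open>X \<subseteq> Y\<close> by blast
  then have "J \<subseteq> insert e Y" by blast
  with J(1) obtain K where K: "K \<in> indeps M" "J \<subseteq> K" "K \<subseteq> insert e Y"
    "card K = rank_of M (insert e Y)"
    using rank_of_basis_extend[OF M] by metis
  have "\<not> K \<subseteq> Y" using card_le_rank_of[OF M K(1), of Y] K(4) less by linarith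
  then have "insert e I \<subseteq> K" "e \<notin> Y" using K J by auto
  then have "insert e I \<in> indeps M" using M K(1) unfolding is_matroid_def by blast
  from card_le_rank_of[OF M this, of "insert e X"] have "card (insert e I) \<le> rank_of M (insert e X)"
    using I by blast
  moreover have "e \<notin> I" using \<open>e \<notin> Y\<close> J by blast
  ultimately show ?thesis using I matroid_finite_indep[OF M I(1)] by simp
qed

lemma finite_flats: "is_matroid M \<Longrightarrow> finite (flats M)"
  unfolding flats_def is_matroid_def by (rule finite_subset[of _ "Pow (ground M)"]) auto

lemma ground_in_flats: "ground M \<in> flats M"
  by (simp add: flats_def)

lemma finite_flat: "is_matroid M \<Longrightarrow> F \<in> flats M \<Longrightarrow> finite F"
  unfolding flats_def is_matroid_def by (auto intro: finite_subset)

section \<open>Restrictions and their flats\<close>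

lemma is_matroid_restriction:
  assumes "is_matroid M"
  shows "is_matroid (restriction M X)"
proof -
  have "\<exists>e\<in>J - I. insert e I \<in> indeps M \<and> insert e I \<subseteq> X"
    if "I \<in> indeps M" "I \<subseteq> X" "J \<in> indeps M" "J \<subseteq> X" "card I < card J" for I J
  proof -
    obtain e where "e \<in> J - I" "insert e I \<in> indeps M"
      using assms \<open>card I < card J\<close> \<open>I \<in> indeps M\<close> \<open>J \<in> indeps M\<close>
      unfolding is_matroid_def by metis
    then show ?thesis using that by blast
  qed
  moreover have "finite (ground M)" "indeps M \<subseteq> Pow (ground M)" "{} \<in> indeps M"
    "\<And>I J. I \<in> indeps M \<Longrightarrow> J \<subseteq> I \<Longrightarrow> J \<in> indeps M"
    using assms unfolding is_matroid_def by blast+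
  ultimately show ?thesis
    unfolding is_matroid_def restriction_def by auto
qed

lemma rank_of_restriction: "X \<subseteq> Y \<Longrightarrow> rank_of (restriction M Y) X = rank_of M X"
  unfolding rank_of_def restriction_def by (simp, intro arg_cong[where f = Max] image_cong) auto

lemma restriction_restriction: "X \<subseteq> Y \<Longrightarrow> restriction (restriction M Y) X = restriction M X"
  unfolding restriction_def by auto

lemma restriction_ground: "is_matroid M \<Longrightarrow> restriction M (ground M) = M"
  unfolding restriction_def is_matroid_def by (cases M) auto

lemma ground_restriction: "F \<in> flats M \<Longrightarrow> ground (restriction M F) = F"
  unfolding restriction_def flats_def by auto

lemma rk_restriction: "F \<in> flats M \<Longrightarrow> rk (restriction M F) = rank_of M F"
  by (simp add: rk_def ground_restriction rank_of_restriction)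

text \<open>An element outside the flat \<open>F\<close> raises the rank of \<open>F\<close>, hence
  by \<open>rank_of_insert_less_mono\<close> that of every subset of \<open>F\<close>; so only
  elements of \<open>F\<close> have to be tested.\<close>

lemma flats_restriction:
  assumes "is_matroid M" "F \<in> flats M"
  shows "flats (restriction M F) = {G \<in> flats M. G \<subseteq> F}"
proof -
  have F: "F \<subseteq> ground M" "\<And>e. e \<in> ground M - F \<Longrightarrow> rank_of M F < rank_of M (insert e F)"
    using assms(2) by (auto simp: flats_def)
  have "G \<in> flats (restriction M F) \<longleftrightarrow> G \<in> flats M" if G: "G \<subseteq> F" for G
  proof -
    have "G \<in> flats (restriction M F) \<longleftrightarrow> (\<forall>e\<in>F - G. rank_of M G < rank_of M (insert e G))"
      using G unfolding flats_def ground_restriction[OF assms(2)]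
      by (auto simp: rank_of_restriction)
    also have "\<dots> \<longleftrightarrow> G \<in> flats M"
      using G F rank_of_insert_less_mono[OF assms(1) G] unfolding flats_def by blast
    finally show ?thesis .
  qed
  moreover have "G \<subseteq> F" if "G \<in> flats (restriction M F)" for G
    using that ground_restriction[OF assms(2)] by (auto simp: flats_def)
  ultimately show ?thesis by blast
qed

section \<open>Contractions and their flats\<close>

lemma rank_of_contraction:
  assumes M: "is_matroid M" and X: "X \<subseteq> ground M - F"
  shows "rank_of (contraction M F) X = rank_of M (X \<union> F) - rank_of M F"
  unfolding rank_of_def[of "contraction M F"]
proof (rule Max_eqI)
  let ?S = "{I \<in> indeps (contraction M F). I \<subseteq> X}"
  have "finite X" using X M unfolding is_matroid_def by (metis finite_Diff finite_subset)
  then show "finite (card ` ?S)" by (auto intro: finite_subset[of _ "Pow X"])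
  show "k \<le> rank_of M (X \<union> F) - rank_of M F" if k: "k \<in> card ` ?S" for k
  proof -
    obtain I where I: "k = card I" "I \<subseteq> X" "rank_of M (I \<union> F) = card I + rank_of M F"
      using k by (auto simp: contraction_def)
    then have "rank_of M (I \<union> F) \<le> rank_of M (X \<union> F)" by (intro rank_of_mono[OF M]) auto
    with I show ?thesis by simp
  qed
  \<comment> \<open>The bound is attained by the part outside \<open>F\<close> of a basis of
    \<open>X \<union> F\<close> that extends a basis of \<open>F\<close>.\<close>
  obtain J where J: "J \<in> indeps M" "J \<subseteq> F" "card J = rank_of M F"
    using rank_of_basis[OF M] .
  then obtain K where K: "K \<in> indeps M" "J \<subseteq> K" "K \<subseteq> X \<union> F" "card K = rank_of M (X \<union> F)"
    using rank_of_basis_extend[OF M, of J "X \<union> F"] by blast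
  have fin: "finite K" using matroid_finite_indep[OF M K(1)] by simp
  have "K \<inter> F \<in> indeps M" using M K(1) unfolding is_matroid_def by blast
  then have "card (K \<inter> F) \<le> card J" using card_le_rank_of[OF M] J by (metis inf_le2)
  moreover have "card J \<le> card (K \<inter> F)" using J K fin by (intro card_mono) auto
  moreover have "card K = card (K - F) + card (K \<inter> F)"
    using fin by (metis card_Int_Diff add.commute)
  ultimately have c: "card K = card (K - F) + rank_of M F" using J by linarith
  have "rank_of M (K - F \<union> F) = card K"
    using rank_of_mono[OF M, of "K - F \<union> F" "X \<union> F"] card_le_rank_of[OF M K(1), of "K - F \<union> F"] K
    by fastforce
  then have "K - F \<in> ?S" using c K X by (auto simp: contraction_def)
  then show "rank_of M (X \<union> F) - rank_of M F \<in> card ` ?S"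
    using c K by (metis (no_types, lifting) add_diff_cancel_right' image_eqI)
qed

lemma flats_contraction:
  assumes M: "is_matroid M" and F: "F \<subseteq> ground M"
  shows "flats (contraction M F) = (\<lambda>G. G - F) ` {G \<in> flats M. F \<subseteq> G}"
proof -
  have ground: "ground (contraction M F) = ground M - F" by (simp add: contraction_def)
  have eq: "X \<in> flats (contraction M F) \<longleftrightarrow> X \<union> F \<in> flats M" if X: "X \<subseteq> ground M - F" for X
  proof -
    have "rank_of (contraction M F) X < rank_of (contraction M F) (insert e X) \<longleftrightarrow>
        rank_of M (X \<union> F) < rank_of M (insert e (X \<union> F))" if "e \<in> ground M - F" for e
      using that X rank_of_mono[OF M, of F "X \<union> F"] rank_of_mono[OF M, of F "insert e (X \<union> F)"]
      by (subst (1 2) rank_of_contraction[OF M]) auto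
    then show ?thesis using X F unfolding flats_def ground by auto
  qed
  show ?thesis
  proof (intro subset_antisym subsetI)
    fix X assume X: "X \<in> flats (contraction M F)"
    then have "X \<subseteq> ground M - F" by (simp add: flats_def ground)
    with eq X have "X \<union> F \<in> flats M" "X = (X \<union> F) - F" by auto
    then show "X \<in> (\<lambda>G. G - F) ` {G \<in> flats M. F \<subseteq> G}" by blast
  next
    fix X assume "X \<in> (\<lambda>G. G - F) ` {G \<in> flats M. F \<subseteq> G}"
    then obtain G where G: "G \<in> flats M" "F \<subseteq> G" "X = G - F" by blast
    then have "X \<union> F = G" "X \<subseteq> ground M - F" by (auto simp: flats_def)
    with eq G show "X \<in> flats (contraction M F)" by simp
  qed
qed

text \<open>Summing to a delta over every interval that starts at \<open>X\<close> determines the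
  Moebius function recursively, so a guessed closed form only has to pass this test.\<close>

lemma moebius_eqI:
  assumes fin: "\<And>Y. Y \<in> L \<Longrightarrow> finite Y"
    and sum: "\<And>Y. Y \<in> L \<Longrightarrow> X \<subseteq> Y \<Longrightarrow>
      (\<Sum>Z\<in>{Z \<in> L. X \<subseteq> Z \<and> Z \<subseteq> Y}. g Z) = (if X = Y then 1 else 0)"
    and Y: "Y \<in> L" "X \<subseteq> Y" and X: "X \<in> L"
  shows "moebius L X Y = g Y"
  using Y
proof (induction "card Y" arbitrary: Y rule: less_induct)
  case less
  have finY: "finite Y" using fin less.prems by blast
  have finL: "finite {Z \<in> L. X \<subseteq> Z \<and> Z \<subset> Y}"
    using finY by (auto intro: finite_subset[of _ "Pow Y"])
  have split: "{Z \<in> L. X \<subseteq> Z \<and> Z \<subseteq> Y} = insert Y {Z \<in> L. X \<subseteq> Z \<and> Z \<subset> Y}"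
    using less.prems by auto
  have s: "g Y + (\<Sum>Z\<in>{Z \<in> L. X \<subseteq> Z \<and> Z \<subset> Y}. g Z) = (if X = Y then 1 else 0)"
    using sum[OF less.prems] finL unfolding split by (subst (asm) sum.insert) auto
  show ?case
  proof (cases "X = Y")
    case True
    then have "{Z \<in> L. X \<subseteq> Z \<and> Z \<subset> Y} = {}" by auto
    with s have "g Y = 1" using True by (simp only: sum.empty if_True add_0_right refl)
    then show ?thesis using True by (simp add: moebius.simps[of L Y Y])
  next
    case False
    have "(\<Sum>Z\<in>{Z \<in> L. X \<subseteq> Z \<and> Z \<subset> Y}. moebius L X Z) =
        (\<Sum>Z\<in>{Z \<in> L. X \<subseteq> Z \<and> Z \<subset> Y}. g Z)"
      using less.hyps finY by (intro sum.cong) (auto intro: psubset_card_mono)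
    then show ?thesis
      using s False finY less.prems by (simp add: moebius.simps[of L X Y] psubset_eq)
  qed
qed

section \<open>Computing inverse Kazhdan--Lusztig polynomials from the flats\<close>

lemma coeff_reverse_poly: "coeff (reverse_poly d p) i = (if i \<le> d then coeff p (d - i) else 0)"
proof -
  have "coeff (reverse_poly d p) i = (\<Sum>j\<le>d. if j = d - i \<and> i \<le> d then coeff p j else 0)"
    unfolding reverse_poly_def coeff_sum by (intro sum.cong) auto
  then show ?thesis by (cases "i \<le> d") auto
qed

lemma reverse_poly_diff:
  fixes p :: "'a::ab_group_add poly"
  shows "reverse_poly d (p - q) = reverse_poly d p - reverse_poly d q"
  by (rule poly_eqI) (simp add: coeff_reverse_poly)

lemma reverse_poly_sum: "reverse_poly d (\<Sum>x\<in>A. f x) = (\<Sum>x\<in>A. reverse_poly d (f x))"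
  by (rule poly_eqI) (simp add: coeff_reverse_poly coeff_sum)

lemma reverse_poly_monom: "k \<le> d \<Longrightarrow> reverse_poly d (monom c k) = monom c (d - k)"
  by (rule poly_eqI) (auto simp: coeff_reverse_poly)

text \<open>The identity \<open>f * zeta = delta\<close> in the incidence algebra of the lattice of
  flats, which characterises its Moebius function. With \<open>f\<close> abstract, the general
  theory applies to any closed form that satisfies it.\<close>

definition zeta_inverse :: "'a matroid \<Rightarrow> ('a set \<Rightarrow> 'a set \<Rightarrow> int) \<Rightarrow> bool" where
  "zeta_inverse M f \<longleftrightarrow> (\<forall>F\<in>flats M. \<forall>G\<in>flats M. F \<subseteq> G \<longrightarrow>
     (\<Sum>Z\<in>{Z \<in> flats M. F \<subseteq> Z \<and> Z \<subseteq> G}. f F Z) = (if F = G then 1 else 0))"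

text \<open>Under \<open>zeta_inverse M f\<close> this is the reversed characteristic polynomial of
  the minor obtained by restricting to \<open>E\<close> and contracting \<open>F\<close>: reversal
  turns the exponent \<open>rk E - rk G\<close> into \<open>rk G - rk F\<close>.\<close>

definition flag_poly :: "'a matroid \<Rightarrow> ('a set \<Rightarrow> 'a set \<Rightarrow> int) \<Rightarrow> 'a set \<Rightarrow> 'a set \<Rightarrow> int poly" where
  "flag_poly M f F E =
     (\<Sum>G\<in>{G \<in> flats M. F \<subseteq> G \<and> G \<subseteq> E}. monom (f F G) (rank_of M G - rank_of M F))"

text \<open>Removing \<open>F\<close> identifies the flats above \<open>F\<close> with the flats of
  the contraction, so the test of \<open>moebius_eqI\<close> becomes an instance of
  \<open>zeta_inverse\<close>.\<close>

lemma moebius_flats_contraction: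
  assumes M: "is_matroid M" and f: "zeta_inverse M f"
    and F: "F \<in> flats M" and G: "G \<in> flats M" "F \<subseteq> G"
  shows "moebius (flats (contraction M F)) {} (G - F) = f F G"
proof -
  have Fg: "F \<subseteq> ground M" using F by (simp add: flats_def)
  note fl = flats_contraction[OF M Fg]
  have "moebius (flats (contraction M F)) {} (G - F) = f F ((G - F) \<union> F)"
  proof (rule moebius_eqI)
    fix Y assume "Y \<in> flats (contraction M F)"
    then obtain H where H: "H \<in> flats M" "F \<subseteq> H" "Y = H - F" unfolding fl by blast
    then show "finite Y" using finite_flat[OF M] by simp
    have "{Z \<in> flats (contraction M F). {} \<subseteq> Z \<and> Z \<subseteq> Y} =
        (\<lambda>Z. Z - F) ` {Z \<in> flats M. F \<subseteq> Z \<and> Z \<subseteq> H}"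
      unfolding fl using H by auto
    moreover have "inj_on (\<lambda>Z. Z - F) {Z \<in> flats M. F \<subseteq> Z \<and> Z \<subseteq> H}"
      by (auto simp: inj_on_def)
    ultimately have "(\<Sum>Z\<in>{Z \<in> flats (contraction M F). {} \<subseteq> Z \<and> Z \<subseteq> Y}. f F (Z \<union> F)) =
        (\<Sum>Z\<in>{Z \<in> flats M. F \<subseteq> Z \<and> Z \<subseteq> H}. f F (Z - F \<union> F))"
      by (simp add: sum.reindex o_def)
    also have "\<dots> = (\<Sum>Z\<in>{Z \<in> flats M. F \<subseteq> Z \<and> Z \<subseteq> H}. f F Z)"
      by (intro sum.cong) (auto simp: Un_absorb2)
    also have "\<dots> = (if F = H then 1 else 0)"
      using f F H unfolding zeta_inverse_def by blast
    also have "\<dots> = (if {} = Y then 1 else 0)" using H by auto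
    finally show "(\<Sum>Z\<in>{Z \<in> flats (contraction M F). {} \<subseteq> Z \<and> Z \<subseteq> Y}. f F (Z \<union> F)) =
      (if {} = Y then 1 else 0)" .
  qed (use F G fl in auto)
  then show ?thesis using G by (simp add: Un_absorb2)
qed

lemma reverse_char_poly_contraction:
  assumes M: "is_matroid M" and f: "zeta_inverse M f" and F: "F \<in> flats M"
  shows "reverse_poly (rk (contraction M F)) (char_poly (contraction M F)) =
    flag_poly M f F (ground M)"
proof -
  have Fg: "F \<subseteq> ground M" using F by (simp add: flats_def)
  note fl = flats_contraction[OF M Fg]
  have rk: "rk (contraction M F) = rank_of M (ground M) - rank_of M F"
    using rank_of_contraction[OF M, of "ground M - F" F] Fg
    by (simp add: rk_def contraction_def Un_absorb2)
  have "inj_on (\<lambda>G. G - F) {G \<in> flats M. F \<subseteq> G}" by (auto simp: inj_on_def)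
  then have "char_poly (contraction M F) = (\<Sum>G\<in>{G \<in> flats M. F \<subseteq> G}.
      monom (moebius (flats (contraction M F)) {} (G - F))
        (rk (contraction M F) - rank_of (contraction M F) (G - F)))"
    unfolding char_poly_def by (subst (1) fl) (simp add: sum.reindex o_def)
  also have "\<dots> = (\<Sum>G\<in>{G \<in> flats M. F \<subseteq> G}.
      monom (f F G) (rank_of M (ground M) - rank_of M G))"
  proof (intro sum.cong refl)
    fix G assume "G \<in> {G \<in> flats M. F \<subseteq> G}"
    then have G: "G \<in> flats M" "F \<subseteq> G" "G \<subseteq> ground M" by (auto simp: flats_def)
    have "rank_of (contraction M F) (G - F) = rank_of M G - rank_of M F"
      using rank_of_contraction[OF M, of "G - F" F] G by (auto simp: Un_absorb2)
    then show "monom (moebius (flats (contraction M F)) {} (G - F))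
        (rk (contraction M F) - rank_of (contraction M F) (G - F)) =
      monom (f F G) (rank_of M (ground M) - rank_of M G)"
      using moebius_flats_contraction[OF M f F G(1,2)] rk rank_of_mono[OF M G(2)]
        rank_of_mono[OF M G(3)] by simp
  qed
  finally have "reverse_poly (rk (contraction M F)) (char_poly (contraction M F)) =
      (\<Sum>G\<in>{G \<in> flats M. F \<subseteq> G}.
        reverse_poly (rank_of M (ground M) - rank_of M F)
          (monom (f F G) (rank_of M (ground M) - rank_of M G)))"
    by (simp only: reverse_poly_sum rk)
  also have "\<dots> = flag_poly M f F (ground M)"
    unfolding flag_poly_def
  proof (intro sum.cong)
    fix G assume "G \<in> {G \<in> flats M. F \<subseteq> G \<and> G \<subseteq> ground M}"
    then have "rank_of M F \<le> rank_of M G" "rank_of M G \<le> rank_of M (ground M)"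
      using rank_of_mono[OF M] by auto
    then show "reverse_poly (rank_of M (ground M) - rank_of M F)
          (monom (f F G) (rank_of M (ground M) - rank_of M G)) =
        monom (f F G) (rank_of M G - rank_of M F)"
      by (subst reverse_poly_monom) auto
  qed (auto simp: flats_def)
  finally show ?thesis .
qed

text \<open>Minors of the restriction are expressed through flats of \<open>M\<close> below
  \<open>E\<close>, so that the whole recursion takes place in one lattice.\<close>

lemma inverse_KL_conditions_restriction:
  assumes M: "is_matroid M" and f: "zeta_inverse M f" and E: "E \<in> flats M"
  shows "inverse_KL_conditions Q (restriction M E) \<longleftrightarrow>
     (rank_of M E = 0 \<longrightarrow> Q (restriction M E) = 1) \<and>
     (rank_of M E > 0 \<longrightarrow> 2 * degree (Q (restriction M E)) < rank_of M E) \<and>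
     (-1) ^ rank_of M E * reverse_poly (rank_of M E) (Q (restriction M E)) =
       (\<Sum>F\<in>{F \<in> flats M. F \<subseteq> E}.
          (-1) ^ rank_of M F * Q (restriction M F) * flag_poly M f F E)"
proof -
  let ?N = "restriction M E"
  have N: "is_matroid ?N" using is_matroid_restriction[OF M] .
  note fl = flats_restriction[OF M E]
  have fN: "zeta_inverse ?N f"
    unfolding zeta_inverse_def fl
  proof (intro ballI impI)
    fix F G assume FG: "F \<in> {G \<in> flats M. G \<subseteq> E}" "G \<in> {G \<in> flats M. G \<subseteq> E}" "F \<subseteq> G"
    then have "{Z \<in> {G \<in> flats M. G \<subseteq> E}. F \<subseteq> Z \<and> Z \<subseteq> G} = {Z \<in> flats M. F \<subseteq> Z \<and> Z \<subseteq> G}"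
      by auto
    then show "(\<Sum>Z\<in>{Z \<in> {G \<in> flats M. G \<subseteq> E}. F \<subseteq> Z \<and> Z \<subseteq> G}. f F Z) = (if F = G then 1 else 0)"
      using f FG unfolding zeta_inverse_def by simp
  qed
  have flag: "flag_poly ?N f F E = flag_poly M f F E" if "F \<subseteq> E" for F
    unfolding flag_poly_def fl using that
    by (intro sum.cong) (auto simp: rank_of_restriction)
  have "(\<Sum>F\<in>flats ?N. (-1) ^ rk (restriction ?N F) * Q (restriction ?N F) *
          reverse_poly (rk (contraction ?N F)) (char_poly (contraction ?N F))) =
      (\<Sum>F\<in>{F \<in> flats M. F \<subseteq> E}. (-1) ^ rank_of M F * Q (restriction M F) * flag_poly M f F E)"
  proof (intro sum.cong fl)
    fix F assume "F \<in> {F \<in> flats M. F \<subseteq> E}"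
    then have F: "F \<in> flats M" "F \<subseteq> E" "F \<in> flats ?N" using fl by auto
    show "(-1) ^ rk (restriction ?N F) * Q (restriction ?N F) *
          reverse_poly (rk (contraction ?N F)) (char_poly (contraction ?N F)) =
        (-1) ^ rank_of M F * Q (restriction M F) * flag_poly M f F E"
      using reverse_char_poly_contraction[OF N fN F(3)] F(2)
      by (simp add: restriction_restriction rk_restriction[OF F(1)] ground_restriction[OF E] flag)
  qed
  then show ?thesis
    unfolding inverse_KL_conditions_def rk_restriction[OF E] by simp
qed

section \<open>Uniqueness and existence of solutions of the recursion\<close>

lemma flag_poly_self:
  assumes "zeta_inverse M f" "E \<in> flats M"
  shows "flag_poly M f E E = 1"
proof -
  have "{Z \<in> flats M. E \<subseteq> Z \<and> Z \<subseteq> E} = {E}" using assms(2) by auto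
  moreover from this have "f E E = 1" using assms unfolding zeta_inverse_def by fastforce
  ultimately show ?thesis by (simp add: flag_poly_def flip: one_pCons monom_0)
qed

text \<open>By induction the summands for flats strictly below \<open>E\<close> agree, so the
  difference of two solutions equals its own reversal in degree \<open>rank_of M E\<close>. In
  positive rank the degree bound kills its upper half, and the reversal carries this to the lower
  half.\<close>

lemma inverse_KL_conditions_unique:
  assumes M: "is_matroid M" and f: "zeta_inverse M f"
    and Q: "\<forall>F\<in>flats M. inverse_KL_conditions Q (restriction M F)"
    and R: "\<forall>F\<in>flats M. inverse_KL_conditions R (restriction M F)"
    and E: "E \<in> flats M"
  shows "Q (restriction M E) = R (restriction M E)"
  using E
proof (induction "card E" arbitrary: E rule: less_induct)
  case less
  let ?r = "rank_of M E" and ?q = "Q (restriction M E)" and ?p = "R (restriction M E)"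
  let ?S = "\<lambda>Q. \<Sum>F\<in>{F \<in> flats M. F \<subset> E}.
    (-1) ^ rank_of M F * Q (restriction M F) * flag_poly M f F E"
  note cond = inverse_KL_conditions_restriction[OF M f less.prems]
  have split: "{F \<in> flats M. F \<subseteq> E} = insert E {F \<in> flats M. F \<subset> E}"
    using less.prems by auto
  have eq: "(-1) ^ ?r * reverse_poly ?r (U (restriction M E)) =
      (-1) ^ ?r * U (restriction M E) + ?S U"
    if "\<forall>F\<in>flats M. inverse_KL_conditions U (restriction M F)" for U :: "'a matroid \<Rightarrow> int poly"
  proof -
    have "inverse_KL_conditions U (restriction M E)" using that less.prems by blast
    then show ?thesis
      unfolding cond split using finite_flats[OF M] flag_poly_self[OF f less.prems]
      by (subst (asm) sum.insert) auto
  qed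
  have "?S Q = ?S R"
    using less.hyps finite_flat[OF M less.prems] by (intro sum.cong) (auto intro: psubset_card_mono)
  then have "(-1) ^ ?r * reverse_poly ?r (?q - ?p) = (-1) ^ ?r * (?q - ?p)"
    using eq[OF Q] eq[OF R] by (simp add: reverse_poly_diff algebra_simps)
  then have rev: "reverse_poly ?r (?q - ?p) = ?q - ?p"
    by simp
  have Q': "inverse_KL_conditions Q (restriction M E)"
    and R': "inverse_KL_conditions R (restriction M E)" using Q R less.prems by auto
  show ?case
  proof (cases "?r = 0")
    case True
    then show ?thesis using Q' R' unfolding cond by simp
  next
    case False
    then have "2 * degree ?q < ?r" "2 * degree ?p < ?r" using Q' R' unfolding cond by auto
    then have high: "coeff (?q - ?p) i = 0" if "?r \<le> 2 * i" for i
      using that by (simp add: coeff_eq_0)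
    have "coeff (?q - ?p) i = 0" for i
    proof (cases "?r \<le> 2 * i")
      case False
      then have "coeff (reverse_poly ?r (?q - ?p)) i = coeff (?q - ?p) (?r - i)"
        unfolding coeff_reverse_poly by simp
      also have "\<dots> = 0" using False by (intro high) auto
      finally show ?thesis unfolding rev .
    qed (rule high)
    then show ?thesis by (metis eq_iff_diff_eq_0 leading_coeff_0_iff)
  qed
qed

text \<open>Exhibiting a solution indexed by flats suffices: it satisfies the description in
  \<open>inverse_KL\<close>, and \<open>inverse_KL_conditions_unique\<close> shows that no other
  value does.\<close>

lemma inverse_KL_eqI:
  assumes M: "is_matroid M" and f: "zeta_inverse M f"
    and rank0: "\<And>E. E \<in> flats M \<Longrightarrow> rank_of M E = 0 \<Longrightarrow> q E = 1"
    and degree: "\<And>E. E \<in> flats M \<Longrightarrow> rank_of M E > 0 \<Longrightarrow> 2 * degree (q E) < rank_of M E"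
    and eq: "\<And>E. E \<in> flats M \<Longrightarrow> (-1) ^ rank_of M E * reverse_poly (rank_of M E) (q E) =
       (\<Sum>F\<in>{F \<in> flats M. F \<subseteq> E}. (-1) ^ rank_of M F * q F * flag_poly M f F E)"
  shows "inverse_KL M = q (ground M)"
proof -
  \<comment> \<open>\<open>restriction M F\<close> has ground set \<open>F\<close>, so this function
    on matroids takes the value \<open>q F\<close> there.\<close>
  let ?Q = "\<lambda>N. q (ground N)"
  have Q: "\<forall>F\<in>flats M. inverse_KL_conditions ?Q (restriction M F)"
  proof
    fix E assume E: "E \<in> flats M"
    have "(\<Sum>F\<in>{F \<in> flats M. F \<subseteq> E}. (-1) ^ rank_of M F * q F * flag_poly M f F E) =
        (\<Sum>F\<in>{F \<in> flats M. F \<subseteq> E}.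
          (-1) ^ rank_of M F * q (ground (restriction M F)) * flag_poly M f F E)"
      by (intro sum.cong) (auto simp: ground_restriction)
    then show "inverse_KL_conditions ?Q (restriction M E)"
      unfolding inverse_KL_conditions_restriction[OF M f E]
      using rank0 degree eq E by (simp add: ground_restriction)
  qed
  show ?thesis
    unfolding inverse_KL_def
  proof (rule the_equality)
    show "\<exists>Q. (\<forall>F\<in>flats M. inverse_KL_conditions Q (restriction M F)) \<and> q (ground M) = Q M"
      using Q by (intro exI[of _ ?Q]) simp
  next
    fix p assume "\<exists>Q. (\<forall>F\<in>flats M. inverse_KL_conditions Q (restriction M F)) \<and> p = Q M"
    then obtain R where R: "\<forall>F\<in>flats M. inverse_KL_conditions R (restriction M F)" "p = R M"
      by blast
    then show "p = q (ground M)"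
      using inverse_KL_conditions_unique[OF M f R(1) Q ground_in_flats] restriction_ground[OF M]
      by simp
  qed
qed

section \<open>Flats of thagomizer matroids\<close>

lemma sum_interval_power:
  fixes a b :: "'a::comm_semiring_1"
  assumes "finite E" "F \<subseteq> E"
  shows "(\<Sum>Z\<in>{Z. F \<subseteq> Z \<and> Z \<subseteq> E}. a ^ card (Z - F) * b ^ card (E - Z)) = (a + b) ^ card (E - F)"
proof -
  have "{Z. F \<subseteq> Z \<and> Z \<subseteq> E} = (\<lambda>X. F \<union> X) ` Pow (E - F)"
  proof (intro subset_antisym subsetI)
    fix Z assume "Z \<in> {Z. F \<subseteq> Z \<and> Z \<subseteq> E}"
    then have "Z = F \<union> (Z - F)" "Z - F \<in> Pow (E - F)" by auto
    then show "Z \<in> (\<lambda>X. F \<union> X) ` Pow (E - F)" by blast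
  qed (use assms in auto)
  moreover have "inj_on (\<lambda>X. F \<union> X) (Pow (E - F))" by (auto simp: inj_on_def)
  ultimately have "(\<Sum>Z\<in>{Z. F \<subseteq> Z \<and> Z \<subseteq> E}. a ^ card (Z - F) * b ^ card (E - Z)) =
      (\<Sum>X\<in>Pow (E - F). a ^ card (F \<union> X - F) * b ^ card (E - (F \<union> X)))"
    by (simp add: sum.reindex o_def)
  also have "\<dots> = (\<Sum>X\<in>Pow (E - F). a ^ card X * b ^ card (E - F - X))"
  proof (intro sum.cong refl)
    fix X assume "X \<in> Pow (E - F)"
    then have "F \<union> X - F = X" "E - (F \<union> X) = E - F - X" by auto
    then show "a ^ card (F \<union> X - F) * b ^ card (E - (F \<union> X)) = a ^ card X * b ^ card (E - F - X)"
      by simp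
  qed
  \<comment> \<open>When the product is expanded, each element chooses \<open>a\<close> if it lies
    in the subset and \<open>b\<close> otherwise.\<close>
  also have "\<dots> = (\<Prod>x\<in>E - F. a + b)" using assms(1) by (subst prod_add) auto
  finally show ?thesis by simp
qed

lemma sum_Pow_power:
  fixes a b :: "'a::comm_semiring_1"
  assumes "finite E"
  shows "(\<Sum>Z\<in>Pow E. a ^ card Z * b ^ card (E - Z)) = (a + b) ^ card E"
  using sum_interval_power[OF assms, of "{}" a b] by (simp add: Pow_def)

text \<open>Each element of \<open>W\<close> independently enters \<open>U\<close>, \<open>V\<close>
  or neither; these choices contribute \<open>a\<close>, \<open>b\<close> and
  \<open>c\<close>.\<close>

lemma sum_disjoint_pairs_power:
  fixes a b c :: "'a::comm_semiring_1"
  assumes "finite W"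
  shows "(\<Sum>(U, V)\<in>Sigma (Pow W) (\<lambda>U. Pow (W - U)). a ^ card U * b ^ card V * c ^ card (W - U - V)) =
    (a + b + c) ^ card W"
proof -
  have "(\<Sum>(U, V)\<in>Sigma (Pow W) (\<lambda>U. Pow (W - U)).
        a ^ card U * b ^ card V * c ^ card (W - U - V)) =
      (\<Sum>U\<in>Pow W. \<Sum>V\<in>Pow (W - U). a ^ card U * b ^ card V * c ^ card (W - U - V))"
    using assms by (subst sum.Sigma) auto
  also have "\<dots> = (\<Sum>U\<in>Pow W. a ^ card U * (b + c) ^ card (W - U))"
  proof (intro sum.cong refl)
    fix U
    have "(\<Sum>V\<in>Pow (W - U). a ^ card U * b ^ card V * c ^ card (W - U - V)) =
        a ^ card U * (\<Sum>V\<in>Pow (W - U). b ^ card V * c ^ card (W - U - V))"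
      by (simp add: sum_distrib_left mult.assoc)
    also have "\<dots> = a ^ card U * (b + c) ^ card (W - U)"
      using assms by (subst sum_Pow_power) auto
    finally show "(\<Sum>V\<in>Pow (W - U). a ^ card U * b ^ card V * c ^ card (W - U - V)) =
        a ^ card U * (b + c) ^ card (W - U)" .
  qed
  also have "\<dots> = (a + b + c) ^ card W"
    using sum_Pow_power[OF assms, of a "b + c"] by (simp add: add.assoc)
  finally show ?thesis .
qed

section \<open>Edge sets given by the presence of \<open>AB\<close> and the spikes joined to
  \<open>A\<close> and to \<open>B\<close>\<close>

definition thag_set :: "bool \<Rightarrow> nat set \<Rightarrow> nat set \<Rightarrow> thag_vertex set set" where
  "thag_set b P Q = (if b then {{VertA, VertB}} else {}) \<union>
     (\<lambda>j. {VertA, Spike j}) ` P \<union> (\<lambda>j. {VertB, Spike j}) ` Q"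

lemma thag_set_edge_iff [simp]:
  "{VertA, VertB} \<in> thag_set b P Q \<longleftrightarrow> b"
  "{VertA, Spike j} \<in> thag_set b P Q \<longleftrightarrow> j \<in> P"
  "{VertB, Spike j} \<in> thag_set b P Q \<longleftrightarrow> j \<in> Q"
  "{VertB, VertA} \<in> thag_set b P Q \<longleftrightarrow> b"
  "{Spike j, VertA} \<in> thag_set b P Q \<longleftrightarrow> j \<in> P"
  "{Spike j, VertB} \<in> thag_set b P Q \<longleftrightarrow> j \<in> Q"
  "{Spike i, Spike j} \<notin> thag_set b P Q"
  "{VertA} \<notin> thag_set b P Q" "{VertB} \<notin> thag_set b P Q" "{Spike j} \<notin> thag_set b P Q"
  by (simp_all add: thag_set_def doubleton_eq_iff image_iff)

lemma thag_set_subset_iff [simp]: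
  "thag_set b P Q \<subseteq> thag_set b' P' Q' \<longleftrightarrow> (b \<longrightarrow> b') \<and> P \<subseteq> P' \<and> Q \<subseteq> Q'"
proof
  assume sub: "thag_set b P Q \<subseteq> thag_set b' P' Q'"
  show "(b \<longrightarrow> b') \<and> P \<subseteq> P' \<and> Q \<subseteq> Q'"
    using subsetD[OF sub, of "{VertA, VertB}"] subsetD[OF sub, of "{VertA, Spike _}"]
      subsetD[OF sub, of "{VertB, Spike _}"] by auto
qed (auto simp: thag_set_def)

lemma thag_set_eq_iff [simp]:
  "thag_set b P Q = thag_set b' P' Q' \<longleftrightarrow> b = b' \<and> P = P' \<and> Q = Q'"
  unfolding set_eq_subset thag_set_subset_iff by auto

lemma thagomizer_edges_eq: "thagomizer_edges n = thag_set True {1..n} {1..n}"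
  by (simp add: thagomizer_edges_def thag_set_def)

lemma ground_thagomizer: "ground (thagomizer n) = thag_set True {1..n} {1..n}"
  by (simp add: thagomizer_def graphic_matroid_def thagomizer_edges_eq)

lemma subset_thag_setE:
  assumes "X \<subseteq> thag_set b P Q"
  obtains b' P' Q' where "X = thag_set b' P' Q'" "b' \<longrightarrow> b" "P' \<subseteq> P" "Q' \<subseteq> Q"
proof -
  have "X = thag_set ({VertA, VertB} \<in> X) {j. {VertA, Spike j} \<in> X} {j. {VertB, Spike j} \<in> X}"
    (is "X = ?Y")
  proof (intro subset_antisym subsetI)
    fix e assume e: "e \<in> X"
    with assms have "e \<in> thag_set b P Q" by blast
    then consider "e = {VertA, VertB}" | j where "e = {VertA, Spike j}" | j where "e = {VertB, Spike j}"
      by (auto simp: thag_set_def split: if_splits)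
    then show "e \<in> ?Y" using e by cases auto
  qed (auto simp: thag_set_def split: if_splits)
  moreover have "{VertA, VertB} \<in> X \<longrightarrow> b" "{j. {VertA, Spike j} \<in> X} \<subseteq> P"
    "{j. {VertB, Spike j} \<in> X} \<subseteq> Q"
    using subsetD[OF assms, of "{VertA, VertB}"] subsetD[OF assms, of "{VertA, Spike _}"]
      subsetD[OF assms, of "{VertB, Spike _}"] by auto
  ultimately show ?thesis by (rule that)
qed

lemma insert_thag_set:
  "insert {VertA, VertB} (thag_set b P Q) = thag_set True P Q"
  "insert {VertA, Spike j} (thag_set b P Q) = thag_set b (insert j P) Q"
  "insert {VertB, Spike j} (thag_set b P Q) = thag_set b P (insert j Q)"
  by (auto simp: thag_set_def)

lemma card_thag_set:
  assumes "finite P" "finite Q"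
  shows "card (thag_set b P Q) = card P + card Q + of_bool b"
proof -
  have "inj_on (\<lambda>j. {VertA, Spike j}) P" "inj_on (\<lambda>j. {VertB, Spike j}) Q"
    by (auto simp: inj_on_def doubleton_eq_iff)
  then have "card ((\<lambda>j. {VertA, Spike j}) ` P) = card P" "card ((\<lambda>j. {VertB, Spike j}) ` Q) = card Q"
    by (simp_all add: card_image)
  moreover have "(\<lambda>j. {VertA, Spike j}) ` P \<inter> (\<lambda>j. {VertB, Spike j}) ` Q = {}"
    "{VertA, VertB} \<notin> (\<lambda>j. {VertA, Spike j}) ` P \<union> (\<lambda>j. {VertB, Spike j}) ` Q"
    by (auto simp: doubleton_eq_iff)
  ultimately show ?thesis
    using assms by (simp add: thag_set_def card_Un_disjoint)
qed

section \<open>Cycles in subgraphs of the thagomizer graph\<close>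

lemma is_cycle_two_neighbours:
  assumes "is_cycle E vs" "v \<in> set vs"
  obtains u w where "u \<in> set vs" "w \<in> set vs" "u \<noteq> w" "u \<noteq> v" "w \<noteq> v" "{v, u} \<in> E" "{v, w} \<in> E"
proof -
  obtain ps qs where split: "vs = ps @ v # qs" using assms(2) by (meson split_list)
  define ws where "ws = qs @ ps"
  \<comment> \<open>After rotation \<open>v\<close> comes first; its neighbours are then the two
    ends of the remaining path, distinct because a cycle has at least three vertices.\<close>
  have c: "is_cycle E (v # ws)"
    using is_cycle_rotate[of E ps "v # qs"] assms(1) split unfolding ws_def by (cases "ps = []") auto
  have set: "set vs = set (v # ws)" by (auto simp: split ws_def)
  have "2 \<le> length ws" "distinct ws" "v \<notin> set ws" using c by (auto simp: is_cycle_def)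
  moreover from this have "ws \<noteq> []" by auto
  ultimately have "hd ws \<noteq> last ws"
    by (simp add: hd_conv_nth last_conv_nth nth_eq_iff_index_eq)
  have "{v, hd ws} \<in> E" "{v, last ws} \<in> E"
    using c \<open>ws \<noteq> []\<close> by (auto simp: is_cycle_def successively_Cons insert_commute)
  then show ?thesis
    using that[of "hd ws" "last ws"] \<open>ws \<noteq> []\<close> \<open>hd ws \<noteq> last ws\<close> \<open>v \<notin> set ws\<close> set by (metis hd_in_set last_in_set list.set_intros(2))
qed

text \<open>The hypothesis allows at most one connection between \<open>A\<close> and
  \<open>B\<close>, through a common spike or along \<open>AB\<close>. On a cycle every spike is
  joined to both \<open>A\<close> and \<open>B\<close>, and having three vertices then forces a
  second connection.\<close>

lemma thag_set_acyclicI: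
  assumes "finite (P \<inter> Q)" "card (P \<inter> Q) + of_bool b \<le> 1"
  shows "\<not> is_cycle (thag_set b P Q) vs"
proof
  assume c: "is_cycle (thag_set b P Q) vs"
  then have len: "3 \<le> card (set vs)" by (simp add: is_cycle_def distinct_card)
  have spike: "j \<in> P \<inter> Q" if j: "Spike j \<in> set vs" for j
  proof -
    obtain u w where uw: "u \<noteq> w" "{Spike j, u} \<in> thag_set b P Q" "{Spike j, w} \<in> thag_set b P Q"
      using is_cycle_two_neighbours[OF c j] .
    then show ?thesis by (cases u; cases w) auto
  qed
  have sub: "set vs \<subseteq> {VertA, VertB} \<union> Spike ` (P \<inter> Q)"
  proof
    fix v assume v: "v \<in> set vs"
    show "v \<in> {VertA, VertB} \<union> Spike ` (P \<inter> Q)"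
    proof (cases v)
      case (Spike j)
      with v spike show ?thesis by blast
    qed simp_all
  qed
  have "card ({VertA, VertB} \<union> Spike ` (P \<inter> Q)) \<le> 2 + card (P \<inter> Q)"
    using card_Un_le[of "{VertA, VertB}" "Spike ` (P \<inter> Q)"] card_image_le[OF assms(1), of Spike]
    by simp
  moreover have "card (set vs) \<le> card ({VertA, VertB} \<union> Spike ` (P \<inter> Q))"
    using sub assms(1) by (intro card_mono) auto
  \<comment> \<open>At least three vertices in a set of at most
    \<open>2 + card (P \<inter> Q)\<close> elements exhaust the bound, so \<open>AB\<close> is
    absent and the vertices are \<open>A\<close>, \<open>B\<close> and one spike.\<close>
  ultimately have "card (P \<inter> Q) = 1" "\<not> b"
    "card (set vs) = card ({VertA, VertB} \<union> Spike ` (P \<inter> Q))"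
    using len assms(2) by (auto split: if_splits)
  then obtain k where k: "P \<inter> Q = {k}" by (auto simp: card_1_singleton_iff)
  have vs: "set vs = {VertA, VertB} \<union> Spike ` (P \<inter> Q)"
    using sub \<open>card (set vs) = _\<close> assms(1) by (intro card_subset_eq) auto
  then have "VertA \<in> set vs" by simp
  then obtain u w where uw: "u \<in> set vs" "w \<in> set vs" "u \<noteq> w" "u \<noteq> VertA" "w \<noteq> VertA"
    "{VertA, u} \<in> thag_set b P Q" "{VertA, w} \<in> thag_set b P Q"
    using is_cycle_two_neighbours[OF c] by metis
  \<comment> \<open>Only \<open>VertB\<close> and the single spike remain for the two distinct
    neighbours of \<open>VertA\<close>.\<close>
  then have "VertB \<in> {u, w}" using vs k by auto
  then show False using uw \<open>\<not> b\<close> by auto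
qed

text \<open>The obstructions are the triangle on \<open>AB\<close> and a common spike, and the
  four-cycle through two common spikes.\<close>

lemma thag_set_acyclicD:
  assumes "\<nexists>vs. is_cycle (thag_set b P Q) vs"
  shows "card (P \<inter> Q) + of_bool b \<le> 1"
proof -
  have "\<not> b" if "j \<in> P \<inter> Q" for j
  proof
    assume b
    then have "is_cycle (thag_set b P Q) [VertA, VertB, Spike j]" using that by (simp add: is_cycle_def)
    with assms show False by blast
  qed
  moreover have "i = j" if "i \<in> P \<inter> Q" "j \<in> P \<inter> Q" for i j
  proof (rule ccontr)
    assume "i \<noteq> j"
    then have "is_cycle (thag_set b P Q) [VertA, Spike i, VertB, Spike j]"
      using that by (simp add: is_cycle_def)
    with assms show False by blast
  qed
  ultimately have "P \<inter> Q = {} \<or> (\<exists>k. P \<inter> Q = {k}) \<and> \<not> b" by blast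
  then show ?thesis by auto
qed

section \<open>Independent sets, rank and flats\<close>

lemma indep_thagomizer_iff:
  assumes "P \<subseteq> {1..n}" "Q \<subseteq> {1..n}"
  shows "thag_set b P Q \<in> indeps (thagomizer n) \<longleftrightarrow> card (P \<inter> Q) + of_bool b \<le> 1"
proof -
  have "finite (P \<inter> Q)" using assms by (meson finite_Int finite_atLeastAtMost finite_subset)
  then have "(\<nexists>vs. is_cycle (thag_set b P Q) vs) \<longleftrightarrow> card (P \<inter> Q) + of_bool b \<le> 1"
    using thag_set_acyclicI thag_set_acyclicD by metis
  then show ?thesis
    using assms by (simp add: thagomizer_def graphic_matroid_def thagomizer_edges_eq)
qed

text \<open>This counts the edges of a spanning forest: one for each spike that is met, and one more
  when \<open>A\<close> and \<open>B\<close> are connected.\<close>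

lemma rank_of_thag_set:
  assumes "P \<subseteq> {1..n}" "Q \<subseteq> {1..n}"
  shows "rank_of (thagomizer n) (thag_set b P Q) = card (P \<union> Q) + of_bool (b \<or> P \<inter> Q \<noteq> {})"
    (is "_ = ?r b P Q")
  unfolding rank_of_def
proof (rule Max_eqI)
  let ?S = "{I \<in> indeps (thagomizer n). I \<subseteq> thag_set b P Q}"
  show "finite (card ` ?S)" using finite_indep_cards[OF is_matroid_thagomizer] by blast
  have fin: "finite P" "finite Q" using assms by (auto intro: finite_subset)
  show "k \<le> ?r b P Q" if "k \<in> card ` ?S" for k
  proof -
    obtain I where I: "k = card I" "I \<in> indeps (thagomizer n)" "I \<subseteq> thag_set b P Q"
      using \<open>k \<in> card ` ?S\<close> by blast
    then obtain c P' Q' where c: "I = thag_set c P' Q'" "c \<longrightarrow> b" "P' \<subseteq> P" "Q' \<subseteq> Q"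
      using subset_thag_setE by metis
    then have fin': "finite P'" "finite Q'" and n: "P' \<subseteq> {1..n}" "Q' \<subseteq> {1..n}"
      using fin assms by (auto intro: finite_subset)
    have ind: "card (P' \<inter> Q') + of_bool c \<le> 1"
      using I(2) indep_thagomizer_iff[OF n] c by simp
    have "card I = card (P' \<union> Q') + (card (P' \<inter> Q') + of_bool c)"
      using fin' card_Un_Int[of P' Q'] by (simp add: c card_thag_set)
    moreover have "card (P' \<union> Q') \<le> card (P \<union> Q)"
      using c fin by (intro card_mono) auto
    moreover have "card (P' \<inter> Q') + of_bool c \<le> of_bool (b \<or> P \<inter> Q \<noteq> {})"
      using ind c by (cases "P' \<inter> Q' = {}") auto
    ultimately show ?thesis unfolding I(1) by linarith
  qed
  show "?r b P Q \<in> card ` ?S"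
  proof (cases "\<not> b \<and> P \<inter> Q \<noteq> {}")
    case True
    then obtain k where k: "k \<in> P \<inter> Q" by blast
    \<comment> \<open>Both edges are kept at the single common spike \<open>k\<close> to connect
      \<open>A\<close> and \<open>B\<close>; the other common spikes keep only the edge to
      \<open>A\<close>.\<close>
    let ?I = "thag_set False P (insert k (Q - P))"
    have "P \<inter> insert k (Q - P) = {k}" "insert k (Q - P) \<subseteq> {1..n}" using k assms by auto
    then have 1: "?I \<in> ?S"
      using indep_thagomizer_iff[of P n "insert k (Q - P)" False] assms k by auto
    have 2: "card ?I = ?r b P Q"
      using True fin k card_Un_disjoint[of P "Q - P"] by (simp add: card_thag_set)
    show ?thesis using imageI[OF 1, of card] unfolding 2 .
  next
    case False
    let ?I = "thag_set b P (Q - P)"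
    have "P \<inter> (Q - P) = {}" "Q - P \<subseteq> {1..n}" using assms by auto
    then have 1: "?I \<in> ?S"
      using indep_thagomizer_iff[of P n "Q - P" b] assms by auto
    have 2: "card ?I = ?r b P Q"
      using False fin card_Un_disjoint[of P "Q - P"] by (auto simp: card_thag_set)
    show ?thesis using imageI[OF 1, of card] unfolding 2 .
  qed
qed

text \<open>If \<open>A\<close> and \<open>B\<close> are connected, a flat must contain
  \<open>AB\<close> and both edges of every spike it meets. If not, every missing edge either
  reaches a new spike or connects \<open>A\<close> and \<open>B\<close>, so it raises the
  rank.\<close>

lemma flats_thagomizer_iff:
  assumes "P \<subseteq> {1..n}" "Q \<subseteq> {1..n}"
  shows "thag_set b P Q \<in> flats (thagomizer n) \<longleftrightarrow> (if b then P = Q else P \<inter> Q = {})"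
proof -
  let ?r = "\<lambda>b P Q. card (P \<union> Q) + of_bool (b \<or> P \<inter> Q \<noteq> {})"
  have fin: "finite P" "finite Q" using assms by (auto intro: finite_subset)
  have "thag_set b P Q \<in> flats (thagomizer n) \<longleftrightarrow>
      (\<forall>e\<in>thag_set True {1..n} {1..n} - thag_set b P Q.
        ?r b P Q < rank_of (thagomizer n) (insert e (thag_set b P Q)))"
    using assms by (simp add: flats_def ground_thagomizer rank_of_thag_set)
  also have "\<dots> \<longleftrightarrow> (\<not> b \<longrightarrow> ?r b P Q < ?r True P Q) \<and>
      (\<forall>j\<in>{1..n} - P. ?r b P Q < ?r b (insert j P) Q) \<and>
      (\<forall>j\<in>{1..n} - Q. ?r b P Q < ?r b P (insert j Q))" (is "_ \<longleftrightarrow> ?R")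
  proof -
    have 1: "rank_of (thagomizer n) (insert {VertA, VertB} (thag_set b P Q)) = ?r True P Q"
      using assms by (simp add: insert_thag_set rank_of_thag_set)
    have 2: "rank_of (thagomizer n) (insert {VertA, Spike j} (thag_set b P Q)) = ?r b (insert j P) Q"
      if "j \<in> {1..n}" for j
      unfolding insert_thag_set using assms that by (subst rank_of_thag_set) auto
    have 3: "rank_of (thagomizer n) (insert {VertB, Spike j} (thag_set b P Q)) = ?r b P (insert j Q)"
      if "j \<in> {1..n}" for j
      unfolding insert_thag_set using assms that by (subst rank_of_thag_set) auto
    have dec: "(\<forall>e\<in>thag_set True {1..n} {1..n} - thag_set b P Q. p e) \<longleftrightarrow>
        (\<not> b \<longrightarrow> p {VertA, VertB}) \<and> (\<forall>j\<in>{1..n} - P. p {VertA, Spike j}) \<and>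
        (\<forall>j\<in>{1..n} - Q. p {VertB, Spike j})" for p
    proof -
      have "thag_set True {1..n} {1..n} - thag_set b P Q = thag_set (\<not> b) ({1..n} - P) ({1..n} - Q)"
      proof (rule set_eqI)
        fix e
        consider "e \<notin> thag_set True UNIV UNIV" | "e = {VertA, VertB}"
          | j where "e = {VertA, Spike j}" | j where "e = {VertB, Spike j}"
          by (auto simp: thag_set_def)
        then show "e \<in> thag_set True {1..n} {1..n} - thag_set b P Q \<longleftrightarrow>
            e \<in> thag_set (\<not> b) ({1..n} - P) ({1..n} - Q)"
        proof cases
          case 1
          then have "e \<notin> thag_set c P' Q'" for c P' Q'
            by (meson subsetD subset_UNIV thag_set_subset_iff)
          then show ?thesis by blast
        qed simp_all
      qed
      then show ?thesis by (auto simp: thag_set_def)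
    qed
    have 4: "(\<forall>j\<in>{1..n} - P. ?r b P Q < rank_of (thagomizer n) (insert {VertA, Spike j} (thag_set b P Q)))
        \<longleftrightarrow> (\<forall>j\<in>{1..n} - P. ?r b P Q < ?r b (insert j P) Q)"
      by (rule ball_cong[OF refl]) (simp only: 2 Diff_iff)
    have 5: "(\<forall>j\<in>{1..n} - Q. ?r b P Q < rank_of (thagomizer n) (insert {VertB, Spike j} (thag_set b P Q)))
        \<longleftrightarrow> (\<forall>j\<in>{1..n} - Q. ?r b P Q < ?r b P (insert j Q))"
      by (rule ball_cong[OF refl]) (simp only: 3 Diff_iff)
    show ?thesis
      unfolding dec 1 4 5 ..
  qed
  also have "\<dots> \<longleftrightarrow> (if b then P = Q else P \<inter> Q = {})"
  proof (cases "b \<or> P \<inter> Q \<noteq> {}")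
    case True
    have r: "?r b P Q = Suc (card (P \<union> Q))" using True by simp
    have rj: "?r b (insert j P) Q = Suc (card (insert j (P \<union> Q)))"
      "?r b P (insert j Q) = Suc (card (insert j (P \<union> Q)))" for j
      using True by auto
    have "?R \<longleftrightarrow> b \<and> (\<forall>j\<in>{1..n} - P. card (P \<union> Q) < card (insert j (P \<union> Q))) \<and>
        (\<forall>j\<in>{1..n} - Q. card (P \<union> Q) < card (insert j (P \<union> Q)))"
      unfolding r rj by simp
    also have "\<dots> \<longleftrightarrow> b \<and> (\<forall>j\<in>{1..n} - P. j \<notin> P \<union> Q) \<and> (\<forall>j\<in>{1..n} - Q. j \<notin> P \<union> Q)"
      using fin by (simp add: card_insert_if)
    also have "\<dots> \<longleftrightarrow> b \<and> P = Q" using assms by blast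
    finally show ?thesis using True by auto
  next
    case False
    then show ?thesis using fin by (auto simp: card_insert_if)
  qed
  finally show ?thesis .
qed

lemma flat_thagomizerE:
  assumes "F \<in> flats (thagomizer n)"
  obtains P Q where "P \<subseteq> {1..n}" "Q \<subseteq> {1..n}" "P \<inter> Q = {}" "F = thag_set False P Q"
  | R where "R \<subseteq> {1..n}" "F = thag_set True R R"
proof -
  have "F \<subseteq> thag_set True {1..n} {1..n}" using assms by (simp add: flats_def ground_thagomizer)
  then obtain b P Q where F: "F = thag_set b P Q" "P \<subseteq> {1..n}" "Q \<subseteq> {1..n}"
    using subset_thag_setE by metis
  then have "if b then P = Q else P \<inter> Q = {}" using assms flats_thagomizer_iff by metis
  then show ?thesis using F that by (cases b) auto
qed

section \<open>The inverse Kazhdan--Lusztig polynomial of a thagomizer matroid\<close>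

text \<open>The flats of this interval that avoid \<open>AB\<close> arise by joining some of the
  remaining spikes \<open>W\<close> to \<open>A\<close> or to \<open>B\<close>; those with
  \<open>AB\<close> are determined by their set of spikes.\<close>

lemma sum_thag_flats_False:
  fixes g :: "thag_vertex set set \<Rightarrow> 'a::comm_monoid_add"
  assumes XY: "X \<inter> Y = {}" "X \<subseteq> R" "Y \<subseteq> R" and R: "R \<subseteq> {1..n}"
  defines "W \<equiv> R - (X \<union> Y)"
  shows "(\<Sum>G\<in>{G \<in> flats (thagomizer n). thag_set False X Y \<subseteq> G \<and> G \<subseteq> thag_set True R R}. g G) =
    (\<Sum>(U, V)\<in>Sigma (Pow W) (\<lambda>U. Pow (W - U)). g (thag_set False (X \<union> U) (Y \<union> V))) +
    (\<Sum>Z\<in>{Z. X \<union> Y \<subseteq> Z \<and> Z \<subseteq> R}. g (thag_set True Z Z))"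
proof -
  let ?S = "Sigma (Pow W) (\<lambda>U. Pow (W - U))" and ?T = "{Z. X \<union> Y \<subseteq> Z \<and> Z \<subseteq> R}"
  let ?h = "\<lambda>(U, V). thag_set False (X \<union> U) (Y \<union> V)" and ?k = "\<lambda>Z. thag_set True Z Z"
  have fin: "finite R" using R finite_subset by blast
  have "{G \<in> flats (thagomizer n). thag_set False X Y \<subseteq> G \<and> G \<subseteq> thag_set True R R} =
      ?h ` ?S \<union> ?k ` ?T" (is "?L = _")
  proof (intro subset_antisym subsetI)
    fix G assume G: "G \<in> ?L"
    then have "G \<in> flats (thagomizer n)" by simp
    then show "G \<in> ?h ` ?S \<union> ?k ` ?T"
    proof (cases rule: flat_thagomizerE)
      case (1 P Q)
      then have sub: "X \<subseteq> P" "Y \<subseteq> Q" "P \<subseteq> R" "Q \<subseteq> R" using G by auto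
      then have "G = ?h (P - X, Q - Y)" using 1 by (auto simp: Un_absorb1)
      moreover have "(P - X, Q - Y) \<in> ?S" using 1 sub unfolding W_def by auto
      ultimately show ?thesis by blast
    next
      case (2 R)
      then show ?thesis using G by auto
    qed
  next
    fix G assume "G \<in> ?h ` ?S \<union> ?k ` ?T"
    then show "G \<in> ?L"
    proof
      assume "G \<in> ?h ` ?S"
      then obtain U V where UV: "(U, V) \<in> ?S" "G = thag_set False (X \<union> U) (Y \<union> V)" by auto
      then have "X \<union> U \<subseteq> R" "Y \<union> V \<subseteq> R" "(X \<union> U) \<inter> (Y \<union> V) = {}"
        using XY unfolding W_def by auto
      moreover from this have "X \<union> U \<subseteq> {1..n}" "Y \<union> V \<subseteq> {1..n}" using R by blast+
      ultimately show ?thesis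
        using UV flats_thagomizer_iff[of "X \<union> U" n "Y \<union> V" False] by auto
    next
      assume "G \<in> ?k ` ?T"
      then obtain Z where "X \<union> Y \<subseteq> Z" "Z \<subseteq> R" "G = thag_set True Z Z" by auto
      then show ?thesis using R flats_thagomizer_iff[of Z n Z True] by auto
    qed
  qed
  moreover have "?h ` ?S \<inter> ?k ` ?T = {}" by auto
  moreover have "inj_on ?h ?S" unfolding W_def by (auto simp: inj_on_def)
  moreover have "inj_on ?k ?T" by (auto simp: inj_on_def)
  moreover have "finite ?S" unfolding W_def using fin by auto
  moreover have "finite ?T" using fin by (auto intro: finite_subset[of _ "Pow R"])
  ultimately show ?thesis
    by (simp add: sum.union_disjoint sum.reindex o_def case_prod_unfold)
qed

lemma sum_thag_flats_True:
  fixes g :: "thag_vertex set set \<Rightarrow> 'a::comm_monoid_add"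
  assumes "S \<subseteq> R" and R: "R \<subseteq> {1..n}"
  shows "(\<Sum>G\<in>{G \<in> flats (thagomizer n). thag_set True S S \<subseteq> G \<and> G \<subseteq> thag_set True R R}. g G) =
    (\<Sum>Z\<in>{Z. S \<subseteq> Z \<and> Z \<subseteq> R}. g (thag_set True Z Z))"
proof -
  let ?T = "{Z. S \<subseteq> Z \<and> Z \<subseteq> R}" and ?k = "\<lambda>Z. thag_set True Z Z"
  have "{G \<in> flats (thagomizer n). thag_set True S S \<subseteq> G \<and> G \<subseteq> thag_set True R R} = ?k ` ?T"
    (is "?L = _")
  proof (intro subset_antisym subsetI)
    fix G assume G: "G \<in> ?L"
    then have "G \<in> flats (thagomizer n)" by simp
    then show "G \<in> ?k ` ?T" by (cases rule: flat_thagomizerE) (use G in auto)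
  next
    fix G assume "G \<in> ?k ` ?T"
    then obtain Z where "S \<subseteq> Z" "Z \<subseteq> R" "G = thag_set True Z Z" by auto
    then show "G \<in> ?L" using R flats_thagomizer_iff[of Z n Z True] by auto
  qed
  moreover have "inj_on ?k ?T" by (auto simp: inj_on_def)
  ultimately show ?thesis by (simp add: sum.reindex o_def)
qed

section \<open>The Moebius function of the lattice of flats\<close>

definition spikes :: "thag_vertex set set \<Rightarrow> nat set" where
  "spikes F = {j. {VertA, Spike j} \<in> F \<or> {VertB, Spike j} \<in> F}"

lemma spikes_thag_set [simp]: "spikes (thag_set b P Q) = P \<union> Q"
  by (auto simp: spikes_def)

lemma rank_of_flat_thagomizer:
  assumes "F \<in> flats (thagomizer n)"
  shows "rank_of (thagomizer n) F = card (spikes F) + of_bool ({VertA, VertB} \<in> F)"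
  using assms by (cases rule: flat_thagomizerE) (simp_all add: rank_of_thag_set)

lemma finite_spikes: "F \<in> flats (thagomizer n) \<Longrightarrow> finite (spikes F)"
  by (erule flat_thagomizerE) (auto intro: finite_subset)

lemma spikes_mono: "F \<subseteq> G \<Longrightarrow> spikes F \<subseteq> spikes G"
  unfolding spikes_def by auto

text \<open>A flat without \<open>AB\<close> is independent and all its subsets are again flats, so
  the lattice below it is Boolean.\<close>

lemma subset_free_thag_set:
  assumes "P \<subseteq> {1..n}" "Q \<subseteq> {1..n}" "P \<inter> Q = {}" "Z \<subseteq> thag_set False P Q"
  shows "Z \<in> flats (thagomizer n)" "{VertA, VertB} \<notin> Z" "card (spikes Z) = card Z" "finite Z"
proof -
  obtain X Y where Z: "Z = thag_set False X Y" "X \<subseteq> P" "Y \<subseteq> Q"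
    using subset_thag_setE[OF assms(4)] by metis
  then have XY: "X \<subseteq> {1..n}" "Y \<subseteq> {1..n}" "X \<inter> Y = {}" using assms by auto
  then show "Z \<in> flats (thagomizer n)" using Z flats_thagomizer_iff by simp
  show "{VertA, VertB} \<notin> Z" by (simp add: Z)
  have fin: "finite X" "finite Y" using XY by (auto intro: finite_subset)
  then show "card (spikes Z) = card Z" using XY by (simp add: Z card_thag_set card_Un_disjoint)
  show "finite Z" using fin by (simp add: Z thag_set_def)
qed

text \<open>The interval from a flat without \<open>AB\<close> to a flat with \<open>AB\<close> is the lattice of flats of a
  thagomizer matroid with \<open>m\<close> spikes, whose characteristic polynomial \<open>(t - 1) (t - 2)\<^sup>m\<close> has the
  constant term \<open>- (-2)\<^sup>m\<close>; all other intervals are Boolean.\<close>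

definition thag_mu :: "thag_vertex set set \<Rightarrow> thag_vertex set set \<Rightarrow> int" where
  "thag_mu F G = (if {VertA, VertB} \<in> G \<and> {VertA, VertB} \<notin> F
     then - ((-2) ^ card (spikes G - spikes F)) else (-1) ^ card (spikes G - spikes F))"

text \<open>The variable lives in any commutative ring: \<open>t = 1\<close> gives the sums in
  \<open>zeta_inverse\<close>, and \<open>t = [:0, 1:]\<close> gives
  \<open>flag_poly\<close>.\<close>

definition mu_sum ::
    "nat \<Rightarrow> 'a::comm_ring_1 \<Rightarrow> thag_vertex set set \<Rightarrow> thag_vertex set set \<Rightarrow> 'a" where
  "mu_sum n t F E = (\<Sum>G\<in>{G \<in> flats (thagomizer n). F \<subseteq> G \<and> G \<subseteq> E}.
     of_int (thag_mu F G) * t ^ (rank_of (thagomizer n) G - rank_of (thagomizer n) F))"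

lemma mu_sum_free:
  assumes "P \<subseteq> {1..n}" "Q \<subseteq> {1..n}" "P \<inter> Q = {}" and F: "F \<subseteq> thag_set False P Q"
  shows "mu_sum n t F (thag_set False P Q) = (1 - t) ^ card (thag_set False P Q - F)"
proof -
  let ?E = "thag_set False P Q"
  note free = subset_free_thag_set[OF assms(1-3)]
  have "mu_sum n t F ?E = (\<Sum>Z\<in>{Z. F \<subseteq> Z \<and> Z \<subseteq> ?E}. (-t) ^ card (Z - F) * 1 ^ card (?E - Z))"
    unfolding mu_sum_def
  proof (intro sum.cong)
    fix Z assume "Z \<in> {Z. F \<subseteq> Z \<and> Z \<subseteq> ?E}"
    then have Z: "F \<subseteq> Z" "Z \<subseteq> ?E" by auto
    have "card (spikes Z - spikes F) = card (Z - F)"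
      using free[OF Z(2)] free[OF F] spikes_mono[OF Z(1)] Z(1)
      by (simp add: card_Diff_subset finite_spikes)
    moreover have "rank_of (thagomizer n) Z - rank_of (thagomizer n) F = card (Z - F)"
      using free[OF Z(2)] free[OF F] Z(1)
      by (simp add: card_Diff_subset rank_of_flat_thagomizer)
    ultimately show "of_int (thag_mu F Z) * t ^ (rank_of (thagomizer n) Z - rank_of (thagomizer n) F) =
        (-t) ^ card (Z - F) * 1 ^ card (?E - Z)"
      using free[OF Z(2)] by (simp add: thag_mu_def power_minus[of t])
  qed (use free in auto)
  also have "\<dots> = (1 - t) ^ card (?E - F)"
    using sum_interval_power[of ?E F "-t" 1] free[of ?E] F by simp
  finally show ?thesis .
qed

lemma mu_sum_True:
  assumes "S \<subseteq> R" "R \<subseteq> {1..n}"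
  shows "mu_sum n t (thag_set True S S) (thag_set True R R) = (1 - t) ^ card (R - S)"
proof -
  have fin: "finite R" using assms finite_subset by blast
  have "mu_sum n t (thag_set True S S) (thag_set True R R) =
      (\<Sum>Z\<in>{Z. S \<subseteq> Z \<and> Z \<subseteq> R}. (-t) ^ card (Z - S) * 1 ^ card (R - Z))"
    unfolding mu_sum_def sum_thag_flats_True[OF assms]
  proof (intro sum.cong refl)
    fix Z assume "Z \<in> {Z. S \<subseteq> Z \<and> Z \<subseteq> R}"
    then have Z: "S \<subseteq> Z" "Z \<subseteq> R" by auto
    then have sub: "Z \<subseteq> {1..n}" "S \<subseteq> {1..n}" "finite S"
      using assms fin by (auto intro: finite_subset)
    then have "rank_of (thagomizer n) (thag_set True Z Z) - rank_of (thagomizer n) (thag_set True S S) =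
        card (Z - S)"
      using Z by (simp add: rank_of_thag_set card_Diff_subset)
    then show "of_int (thag_mu (thag_set True S S) (thag_set True Z Z)) *
        t ^ (rank_of (thagomizer n) (thag_set True Z Z) - rank_of (thagomizer n) (thag_set True S S)) =
        (-t) ^ card (Z - S) * 1 ^ card (R - Z)"
      by (simp add: thag_mu_def power_minus[of t])
  qed
  also have "\<dots> = (1 - t) ^ card (R - S)"
    using sum_interval_power[OF fin assms(1), of "-t" 1] by simp
  finally show ?thesis .
qed

text \<open>For \<open>m\<close> remaining spikes the flats without \<open>AB\<close> give
  \<open>(1 - 2 * t) ^ m\<close>, since each spike is left out or joined to one of \<open>A\<close>
  and \<open>B\<close>; the flats with \<open>AB\<close> give \<open>- t\<close> times the same
  power. The total is the reversal of \<open>(t - 1) (t - 2) ^ m\<close>.\<close>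

lemma mu_sum_False_True:
  assumes XY: "X \<inter> Y = {}" "X \<subseteq> R" "Y \<subseteq> R" and R: "R \<subseteq> {1..n}"
  shows "mu_sum n t (thag_set False X Y) (thag_set True R R) =
    (1 - t) * (1 - 2 * t) ^ card (R - (X \<union> Y))"
proof -
  define W where "W = R - (X \<union> Y)"
  have fin: "finite R" using R finite_subset by blast
  then have finW: "finite W" by (simp add: W_def)
  have finXY: "finite X" "finite Y" using XY fin by (auto intro: finite_subset)
  let ?F = "thag_set False X Y"
  let ?g = "\<lambda>G. of_int (thag_mu ?F G) * t ^ (rank_of (thagomizer n) G - rank_of (thagomizer n) ?F)"
  have F: "rank_of (thagomizer n) ?F = card (X \<union> Y)"
    using rank_of_thag_set[of X n Y False] XY R by auto
  have "(\<Sum>(U, V)\<in>Sigma (Pow W) (\<lambda>U. Pow (W - U)). ?g (thag_set False (X \<union> U) (Y \<union> V))) =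
      (\<Sum>(U, V)\<in>Sigma (Pow W) (\<lambda>U. Pow (W - U)).
        (-t) ^ card U * (-t) ^ card V * 1 ^ card (W - U - V))"
  proof (intro sum.cong refl, clarify)
    fix U V assume UV: "U \<subseteq> W" "V \<subseteq> W - U"
    then have finUV: "finite U" "finite V" using finW by (auto intro: finite_subset)
    have disj: "(X \<union> U) \<inter> (Y \<union> V) = {}" and sub: "X \<union> U \<subseteq> {1..n}" "Y \<union> V \<subseteq> {1..n}"
      using UV XY R unfolding W_def by blast+
    have card: "card (X \<union> U \<union> (Y \<union> V) - (X \<union> Y)) = card U + card V"
    proof -
      have "X \<union> U \<union> (Y \<union> V) - (X \<union> Y) = U \<union> V" using UV unfolding W_def by blast
      moreover have "U \<inter> V = {}" using UV by blast
      ultimately show ?thesis using finUV by (simp add: card_Un_disjoint)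
    qed
    moreover have "card (X \<union> U \<union> (Y \<union> V) - (X \<union> Y)) = card (X \<union> U \<union> (Y \<union> V)) - card (X \<union> Y)"
      using finXY by (intro card_Diff_subset) auto
    ultimately have "rank_of (thagomizer n) (thag_set False (X \<union> U) (Y \<union> V)) -
        rank_of (thagomizer n) ?F = card U + card V"
      using rank_of_thag_set[OF sub, of False] F disj by simp
    moreover have "thag_mu ?F (thag_set False (X \<union> U) (Y \<union> V)) = (-1) ^ (card U + card V)"
      unfolding thag_mu_def by (simp only: spikes_thag_set card thag_set_edge_iff) simp
    ultimately show "?g (thag_set False (X \<union> U) (Y \<union> V)) =
        (-t) ^ card U * (-t) ^ card V * 1 ^ card (W - U - V)"
      by (simp only: power_minus[of t]) (simp add: power_add)
  qed
  also have "\<dots> = (1 - 2 * t) ^ card W"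
    using sum_disjoint_pairs_power[OF finW, of "-t" "-t" 1] by (simp add: algebra_simps)
  finally have 1: "(\<Sum>(U, V)\<in>Sigma (Pow W) (\<lambda>U. Pow (W - U)).
      ?g (thag_set False (X \<union> U) (Y \<union> V))) = (1 - 2 * t) ^ card W" .
  have "(\<Sum>Z\<in>{Z. X \<union> Y \<subseteq> Z \<and> Z \<subseteq> R}. ?g (thag_set True Z Z)) =
      (\<Sum>Z\<in>{Z. X \<union> Y \<subseteq> Z \<and> Z \<subseteq> R}. - t * ((-2 * t) ^ card (Z - (X \<union> Y)) * 1 ^ card (R - Z)))"
  proof (intro sum.cong refl)
    fix Z assume "Z \<in> {Z. X \<union> Y \<subseteq> Z \<and> Z \<subseteq> R}"
    then have Z: "X \<union> Y \<subseteq> Z" "Z \<subseteq> R" by auto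
    then have Zn: "Z \<subseteq> {1..n}" "finite Z" using R fin by (auto intro: finite_subset)
    have "card (Z - (X \<union> Y)) = card Z - card (X \<union> Y)" "card (X \<union> Y) \<le> card Z"
      using finXY Z Zn by (auto intro!: card_Diff_subset card_mono)
    then have "rank_of (thagomizer n) (thag_set True Z Z) - rank_of (thagomizer n) ?F =
        Suc (card (Z - (X \<union> Y)))"
      using rank_of_thag_set[OF Zn(1) Zn(1), of True] F by simp
    moreover have "thag_mu ?F (thag_set True Z Z) = - ((-2) ^ card (Z - (X \<union> Y)))"
      by (simp add: thag_mu_def)
    ultimately show "?g (thag_set True Z Z) =
        - t * ((-2 * t) ^ card (Z - (X \<union> Y)) * 1 ^ card (R - Z))"
      by (simp only: power_mult_distrib) simp
  qed
  also have "\<dots> = - t * (1 - 2 * t) ^ card W"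
    using sum_interval_power[OF fin, of "X \<union> Y" "-2 * t" 1] XY
    unfolding sum_distrib_left[symmetric] by (simp add: W_def)
  finally have 2: "(\<Sum>Z\<in>{Z. X \<union> Y \<subseteq> Z \<and> Z \<subseteq> R}. ?g (thag_set True Z Z)) =
      - t * (1 - 2 * t) ^ card W" .
  show ?thesis
    unfolding mu_sum_def sum_thag_flats_False[OF assms] W_def[symmetric] 1 2
    by (simp add: algebra_simps)
qed

text \<open>At \<open>t = 1\<close> the factor \<open>1 - t\<close> of the closed forms vanishes,
  and it occurs to a positive power unless \<open>F = G\<close>.\<close>

lemma zeta_inverse_thag_mu: "zeta_inverse (thagomizer n) thag_mu"
  unfolding zeta_inverse_def
proof (intro ballI impI)
  fix F G assume F: "F \<in> flats (thagomizer n)" and G: "G \<in> flats (thagomizer n)" and FG: "F \<subseteq> G"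
  have "(\<Sum>Z\<in>{Z \<in> flats (thagomizer n). F \<subseteq> Z \<and> Z \<subseteq> G}. thag_mu F Z) = mu_sum n 1 F G"
    by (simp add: mu_sum_def)
  also have "\<dots> = (if F = G then 1 else 0)"
    using G
  proof (cases rule: flat_thagomizerE)
    case (1 P Q)
    have "finite (G - F)" using finite_flat[OF is_matroid_thagomizer G] by simp
    moreover have "G - F = {} \<longleftrightarrow> F = G" using FG by blast
    ultimately show ?thesis
      using mu_sum_free[OF 1(1-3), of F 1] FG unfolding 1(4) by (simp add: power_0_left)
  next
    case (2 R)
    have fin: "finite R" using 2 finite_subset by blast
    show ?thesis
      using F
    proof (cases rule: flat_thagomizerE)
      case (1 X Y)
      then have "X \<subseteq> R" "Y \<subseteq> R" using FG 2 by auto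
      then show ?thesis using mu_sum_False_True[OF 1(3) _ _ 2(1), of 1] 1(4) 2(2) by simp
    next
      case (2 S)
      then have "S \<subseteq> R" using FG \<open>G = thag_set True R R\<close> by auto
      moreover from this have "R - S = {} \<longleftrightarrow> S = R" by blast
      ultimately show ?thesis
        using mu_sum_True[OF _ \<open>R \<subseteq> {1..n}\<close>, of S 1] 2(2) \<open>G = thag_set True R R\<close> fin
        by (simp add: power_0_left)
    qed
  qed
  finally show "(\<Sum>Z\<in>{Z \<in> flats (thagomizer n). F \<subseteq> Z \<and> Z \<subseteq> G}. thag_mu F Z) =
    (if F = G then 1 else 0)" .
qed

lemma flag_poly_thag_mu: "flag_poly (thagomizer n) thag_mu F E = mu_sum n [:0, 1:] F E"
  unfolding flag_poly_def mu_sum_def by (simp add: monom_altdef of_int_poly)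

section \<open>Ballot polynomials and their reversal\<close>

definition ballot_poly :: "nat \<Rightarrow> int poly" where
  "ballot_poly k = poly_cutoff (Suc (k div 2)) ([:1, -1:] * [:1, 1:] ^ k)"

lemma coeff_ballot_full:
  "coeff ([:1, -1:] * [:1, 1:] ^ k :: int poly) i =
     int (k choose i) - (if i = 0 then 0 else int (k choose (i - 1)))"
proof -
  have "[:1, -1:] * [:1, 1:] ^ k = [:1, 1:] ^ k - pCons 0 ([:1, 1:] ^ k :: int poly)"
    by simp
  moreover have "coeff ([:1, 1:] ^ k :: int poly) j = int (k choose j)" for j
  proof (cases "j \<le> k")
    case False
    then have "degree ([:1, 1:] ^ k :: int poly) < j"
      using degree_power_le[of "[:1, 1 :: int:]" k] by simp
    then show ?thesis using False by (simp add: coeff_eq_0)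
  qed (simp add: coeff_linear_poly_power)
  ultimately show ?thesis by (cases i) (simp_all only: coeff_diff coeff_pCons nat.case, simp_all)
qed

text \<open>The nonzero values are ballot numbers; the cutoff at \<open>Suc (k div 2)\<close> keeps
  exactly the exponents \<open>i\<close> with \<open>2 * i \<le> k\<close>.\<close>

lemma coeff_ballot_poly:
  "coeff (ballot_poly k) i =
     (if 2 * i \<le> k then int (k choose i) - (if i = 0 then 0 else int (k choose (i - 1))) else 0)"
  unfolding ballot_poly_def coeff_poly_cutoff coeff_ballot_full by auto

lemma degree_ballot_poly: "2 * degree (ballot_poly k) \<le> k"
proof -
  have "degree (ballot_poly k) \<le> k div 2"
    by (rule degree_le) (auto simp: coeff_ballot_poly)
  then show ?thesis by simp
qed

text \<open>\<open>(1 - t) (1 + t) ^ k\<close> changes sign under reversal in degree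
  \<open>k + 1\<close>, so its reversed lower half is minus its upper half.\<close>

lemma reverse_ballot_poly:
  "reverse_poly (k + 1) (ballot_poly k) = ballot_poly k - [:1, -1:] * [:1, 1:] ^ k"
proof (rule poly_eqI)
  fix i
  define c where "c j = coeff ([:1, -1:] * [:1, 1:] ^ k :: int poly) j" for j
  have H: "coeff (ballot_poly k) j = (if 2 * j \<le> k then c j else 0)" for j
    by (simp only: c_def coeff_ballot_poly coeff_ballot_full)
  have c0: "c j = 0" if "j > k + 1" for j
    using that by (simp only: c_def coeff_ballot_full) (simp add: binomial_eq_0)
  have anti: "c (k + 1 - j) = - c j" if j: "j \<le> k + 1" for j
  proof -
    consider "j = 0" | "j = k + 1" | "1 \<le> j" "j \<le> k" using j by linarith
    then show ?thesis
    proof cases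
      case 3
      have "k choose (k + 1 - j) = k choose (j - 1)" "k choose (k + 1 - j - 1) = k choose j"
        using 3 binomial_symmetric[of "j - 1" k] binomial_symmetric[of j k] by (auto simp: Suc_diff_le)
      then show ?thesis using 3 by (simp only: c_def coeff_ballot_full) simp
    qed (simp_all only: c_def coeff_ballot_full, simp_all)
  qed
  have "coeff (reverse_poly (k + 1) (ballot_poly k)) i =
      (if i \<le> k + 1 \<and> 2 * (k + 1 - i) \<le> k then - c i else 0)"
    using anti[of i] by (simp add: coeff_reverse_poly H)
  also have "\<dots> = (if 2 * i \<le> k then 0 else - c i)"
  proof (cases "i \<le> k + 1")
    case True
    \<comment> \<open>The middle index belongs to neither half; antisymmetry makes its coefficient
      its own negative.\<close>
    then have "c i = 0" if "2 * i = k + 1"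
    proof -
      have "k + 1 - i = i" using that by linarith
      then show ?thesis using anti[OF True] by simp
    qed
    then show ?thesis using True by auto
  next
    case False
    then show ?thesis using c0[of i] by simp
  qed
  finally show "coeff (reverse_poly (k + 1) (ballot_poly k)) i =
      coeff (ballot_poly k - [:1, -1:] * [:1, 1:] ^ k) i"
    by (simp only: coeff_diff H c_def[symmetric]) simp
qed

section \<open>Verification of the recursion for the candidate polynomials\<close>

lemma reverse_poly_shift:
  fixes p :: "'a::comm_semiring_1 poly"
  assumes "degree p \<le> d"
  shows "reverse_poly (d + e) p = [:0, 1:] ^ e * reverse_poly d p"
proof (rule poly_eqI)
  fix i
  have "[:0, 1:] ^ e = (monom 1 e :: 'a poly)" by (simp add: monom_altdef)
  then show "coeff (reverse_poly (d + e) p) i = coeff ([:0, 1:] ^ e * reverse_poly d p) i"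
    using assms by (auto simp: coeff_reverse_poly coeff_monom_mult coeff_eq_0)
qed

text \<open>The candidate for the restriction to the flat \<open>F\<close>; the value
  \<open>1\<close> belongs to the Boolean restrictions. The binomial sum for \<open>Q\<close> is
  written over subsets so that it can be interchanged with the sum over flats.\<close>

definition thag_KL :: "thag_vertex set set \<Rightarrow> int poly" where
  "thag_KL F = (if {VertA, VertB} \<in> F then \<Sum>J\<in>Pow (spikes F). ballot_poly (card J) else 1)"

text \<open>Both sides equal
  \<open>(-1) ^ Suc (card R) * (A - (1 - T) * (1 + 2 * T) ^ card R)\<close>, with \<open>A\<close>
  as defined in the proof. On the right, the flats without \<open>AB\<close> yield the power of
  \<open>1 + 2 * T\<close> and the flats with \<open>AB\<close> yield \<open>A\<close>.\<close>

lemma thag_KL_eq_True: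
  assumes R: "R \<subseteq> {1..n}"
  shows "(-1) ^ Suc (card R) * reverse_poly (Suc (card R)) (\<Sum>J\<in>Pow R. ballot_poly (card J)) =
    (\<Sum>F\<in>{F \<in> flats (thagomizer n). F \<subseteq> thag_set True R R}.
      (-1) ^ rank_of (thagomizer n) F * thag_KL F * mu_sum n [:0, 1:] F (thag_set True R R))"
    (is "?lhs = ?rhs")
proof -
  define T :: "int poly" where "T = [:0, 1:]"
  define H where "H J = ballot_poly (card J)" for J :: "nat set"
  define A where "A = (\<Sum>J\<in>Pow R. H J * T ^ card (R - J))"
  have fin: "finite R" using R finite_subset by blast
  have T: "[:1, -1:] = 1 - T" "[:1, 1:] = 1 + T"
    by (simp_all add: T_def one_pCons)
  have rev: "reverse_poly (Suc (card R)) (H J) =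
      H J * T ^ card (R - J) - (1 - T) * ((1 + T) ^ card J * T ^ card (R - J))" if "J \<in> Pow R" for J
  proof -
    have J: "J \<subseteq> R" "finite J" using that fin by (auto intro: finite_subset)
    then have c: "Suc (card R) = (card J + 1) + card (R - J)"
      using card_mono[OF fin J(1)] by (simp add: card_Diff_subset)
    have "degree (H J) \<le> card J + 1" using degree_ballot_poly[of "card J"] by (simp add: H_def)
    then have "reverse_poly (Suc (card R)) (H J) = T ^ card (R - J) * reverse_poly (card J + 1) (H J)"
      unfolding c T_def by (rule reverse_poly_shift)
    then show ?thesis
      unfolding H_def reverse_ballot_poly T by (simp add: algebra_simps)
  qed
  have "reverse_poly (Suc (card R)) (\<Sum>J\<in>Pow R. H J) =
      A - (1 - T) * (\<Sum>J\<in>Pow R. (1 + T) ^ card J * T ^ card (R - J))"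
    unfolding reverse_poly_sum A_def sum_distrib_left sum_subtractf[symmetric]
    by (intro sum.cong refl rev)
  also have "\<dots> = A - (1 - T) * (1 + 2 * T) ^ card R"
  proof -
    have "1 + T + T = 1 + 2 * T" by simp
    then show ?thesis by (simp only: sum_Pow_power[OF fin])
  qed
  finally have lhs: "?lhs = (-1) ^ Suc (card R) * (A - (1 - T) * (1 + 2 * T) ^ card R)"
    by (simp add: H_def)
  let ?g = "\<lambda>F. (-1) ^ rank_of (thagomizer n) F * thag_KL F * mu_sum n [:0, 1:] F (thag_set True R R)"
  \<comment> \<open>The empty flat is written as a \<open>thag_set\<close>, so that the sum runs
    over an interval covered by \<open>sum_thag_flats_False\<close>.\<close>
  have "?rhs = (\<Sum>F\<in>{F \<in> flats (thagomizer n). thag_set False {} {} \<subseteq> F \<and> F \<subseteq> thag_set True R R}. ?g F)"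
    by (simp add: thag_set_def[of False "{}"])
  also have "\<dots> = (\<Sum>(U, V)\<in>Sigma (Pow R) (\<lambda>U. Pow (R - U)). ?g (thag_set False U V)) +
      (\<Sum>Z\<in>Pow R. ?g (thag_set True Z Z))"
    using sum_thag_flats_False[of "{}" "{}" R n ?g] R by (simp add: Pow_def)
  also have "(\<Sum>(U, V)\<in>Sigma (Pow R) (\<lambda>U. Pow (R - U)). ?g (thag_set False U V)) =
      (\<Sum>(U, V)\<in>Sigma (Pow R) (\<lambda>U. Pow (R - U)).
        (1 - T) * ((-1) ^ card U * (-1) ^ card V * (1 - 2 * T) ^ card (R - U - V)))"
  proof (intro sum.cong refl, clarify)
    fix U V assume UV: "U \<subseteq> R" "V \<subseteq> R - U"
    then have disj: "U \<inter> V = {}" "V \<subseteq> R" and sub: "U \<subseteq> {1..n}" "V \<subseteq> {1..n}" using R by auto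
    then have fUV: "finite U" "finite V" by (auto intro: finite_subset)
    have "rank_of (thagomizer n) (thag_set False U V) = card U + card V"
      using rank_of_thag_set[OF sub, of False] disj fUV by (simp add: card_Un_disjoint)
    moreover have "R - (U \<union> V) = R - U - V" by blast
    ultimately show "?g (thag_set False U V) =
        (1 - T) * ((-1) ^ card U * (-1) ^ card V * (1 - 2 * T) ^ card (R - U - V))"
      using mu_sum_False_True[OF disj(1) UV(1) disj(2) R, of T] unfolding T_def[symmetric]
      by (simp add: thag_KL_def power_add)
  qed
  also have "\<dots> = (1 - T) * (\<Sum>(U, V)\<in>Sigma (Pow R) (\<lambda>U. Pow (R - U)).
      (-1) ^ card U * (-1) ^ card V * (1 - 2 * T) ^ card (R - U - V))"
    by (simp add: sum_distrib_left case_prod_unfold)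
  also have "\<dots> = (1 - T) * (- (1 + 2 * T)) ^ card R"
    using sum_disjoint_pairs_power[OF fin, of "-1" "-1" "1 - 2 * T"] by simp
  \<comment> \<open>The inner index runs over the members of \<open>Pow R\<close> below
    \<open>Z\<close>, the form in which the two sums can be swapped.\<close>
  also have "(\<Sum>Z\<in>Pow R. ?g (thag_set True Z Z)) =
      (\<Sum>Z\<in>Pow R. \<Sum>J\<in>{J \<in> Pow R. J \<subseteq> Z}. - ((-1) ^ card Z * H J * (1 - T) ^ card (R - Z)))"
  proof (intro sum.cong refl)
    fix Z assume Z: "Z \<in> Pow R"
    then have "rank_of (thagomizer n) (thag_set True Z Z) = Suc (card Z)"
      using rank_of_thag_set[of Z n Z True] R by auto
    moreover have "{J \<in> Pow R. J \<subseteq> Z} = Pow Z" using Z by auto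
    ultimately show "?g (thag_set True Z Z) =
        (\<Sum>J\<in>{J \<in> Pow R. J \<subseteq> Z}. - ((-1) ^ card Z * H J * (1 - T) ^ card (R - Z)))"
      using Z mu_sum_True[of Z R n T] R unfolding T_def[symmetric]
      by (simp add: thag_KL_def H_def sum_negf sum_distrib_left sum_distrib_right)
  qed
  also have "\<dots> = (\<Sum>J\<in>Pow R. \<Sum>Z\<in>{Z \<in> Pow R. J \<subseteq> Z}.
      - ((-1) ^ card Z * H J * (1 - T) ^ card (R - Z)))"
    using fin by (intro sum.swap_restrict) auto
  also have "\<dots> = (\<Sum>J\<in>Pow R. - ((-1) ^ card R) * (H J * T ^ card (R - J)))"
  proof (intro sum.cong refl)
    fix J assume "J \<in> Pow R"
    then have J: "J \<subseteq> R" "finite J" using fin by (auto intro: finite_subset)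
    have "(\<Sum>Z\<in>{Z \<in> Pow R. J \<subseteq> Z}. - ((-1) ^ card Z * H J * (1 - T) ^ card (R - Z))) =
        (\<Sum>Z\<in>{Z. J \<subseteq> Z \<and> Z \<subseteq> R}.
          - ((-1) ^ card J) * H J * ((-1) ^ card (Z - J) * (1 - T) ^ card (R - Z)))"
    proof (intro sum.cong)
      fix Z assume "Z \<in> {Z. J \<subseteq> Z \<and> Z \<subseteq> R}"
      then have "J \<subseteq> Z" "finite Z" using fin by (auto intro: finite_subset)
      then have "card Z = card J + card (Z - J)"
        using card_mono[of Z J] J by (simp add: card_Diff_subset)
      then show "- ((-1) ^ card Z * H J * (1 - T) ^ card (R - Z)) =
          - ((-1) ^ card J) * H J * ((-1) ^ card (Z - J) * (1 - T) ^ card (R - Z))"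
        by (simp add: power_add)
    qed auto
    \<comment> \<open>The sum over all \<open>Z\<close> between \<open>J\<close> and
      \<open>R\<close> collapses: \<open>-1 + (1 - T)\<close> is \<open>- T\<close>, which produces
      the power of \<open>T\<close> in \<open>A\<close>.\<close>
    also have "\<dots> = - ((-1) ^ card J) * H J * (-1 + (1 - T)) ^ card (R - J)"
      by (simp only: sum_interval_power[OF fin J(1)] flip: sum_distrib_left)
    also have "\<dots> = - ((-1) ^ card J * (-1) ^ card (R - J)) * (H J * T ^ card (R - J))"
      by (simp add: power_minus[of T])
    also have "(-1) ^ card J * (-1) ^ card (R - J) = ((-1) ^ card R :: int poly)"
      using card_mono[OF fin J(1)] J by (simp add: card_Diff_subset flip: power_add)
    finally show "(\<Sum>Z\<in>{Z \<in> Pow R. J \<subseteq> Z}. - ((-1) ^ card Z * H J * (1 - T) ^ card (R - Z))) =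
        - ((-1) ^ card R) * (H J * T ^ card (R - J))" .
  qed
  also have "\<dots> = - ((-1) ^ card R) * A"
    unfolding A_def sum_distrib_left ..
  finally have "?rhs = (1 - T) * (- (1 + 2 * T)) ^ card R + - ((-1) ^ card R) * A" .
  then show ?thesis
    unfolding lhs power_minus[of "1 + 2 * T"] by (simp add: algebra_simps)
qed

text \<open>Below \<open>E\<close> the lattice is Boolean and every candidate is \<open>1\<close>,
  so the sum is \<open>(- T) ^ card E\<close>, the signed reversal of \<open>1\<close>.\<close>

lemma thag_KL_eq_free:
  assumes "P \<subseteq> {1..n}" "Q \<subseteq> {1..n}" "P \<inter> Q = {}" and E: "E = thag_set False P Q"
  shows "(-1) ^ card E * reverse_poly (card E) 1 =
    (\<Sum>F\<in>{F \<in> flats (thagomizer n). F \<subseteq> E}.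
      (-1) ^ rank_of (thagomizer n) F * thag_KL F * mu_sum n [:0, 1:] F E)"
proof -
  define T :: "int poly" where "T = [:0, 1:]"
  note free = subset_free_thag_set[OF assms(1-3), folded E]
  have "(\<Sum>F\<in>{F \<in> flats (thagomizer n). F \<subseteq> E}.
      (-1) ^ rank_of (thagomizer n) F * thag_KL F * mu_sum n T F E) =
      (\<Sum>F\<in>Pow E. (-1) ^ card F * (1 - T) ^ card (E - F))"
  proof (intro sum.cong)
    fix F assume "F \<in> Pow E"
    then have "F \<subseteq> E" by simp
    then show "(-1) ^ rank_of (thagomizer n) F * thag_KL F * mu_sum n T F E =
        (-1) ^ card F * (1 - T) ^ card (E - F)"
      using mu_sum_free[OF assms(1-3), of F T] free[OF \<open>F \<subseteq> E\<close>]
      by (simp add: E rank_of_flat_thagomizer thag_KL_def)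
  qed (use free in auto)
  also have "\<dots> = (-1) ^ card E * T ^ card E"
    using sum_Pow_power[of E "-1" "1 - T"] free[of E] by (simp add: power_minus[of T])
  also have "T ^ card E = reverse_poly (card E) 1"
    using reverse_poly_monom[of 0 "card E" "1 :: int"] by (simp add: T_def monom_altdef one_pCons)
  finally show ?thesis unfolding T_def by simp
qed

theorem inverse_KL_thagomizer:
  "inverse_KL (thagomizer n) = (\<Sum>J\<in>Pow {1..n}. ballot_poly (card J))"
proof -
  have "inverse_KL (thagomizer n) = thag_KL (ground (thagomizer n))"
  proof (rule inverse_KL_eqI[OF is_matroid_thagomizer zeta_inverse_thag_mu])
    fix E assume E: "E \<in> flats (thagomizer n)"
    note rank = rank_of_flat_thagomizer[OF E]
    show "thag_KL E = 1" if "rank_of (thagomizer n) E = 0"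
      using that by (simp add: rank thag_KL_def split: if_splits)
    show "2 * degree (thag_KL E) < rank_of (thagomizer n) E" if "rank_of (thagomizer n) E > 0"
    proof (cases "{VertA, VertB} \<in> E")
      case True
      \<comment> \<open>The rank is \<open>card (spikes E) + 1\<close>, so this bound is just strong
        enough.\<close>
      have "degree (thag_KL E) \<le> card (spikes E) div 2"
      proof (rule degree_le, intro allI impI)
        fix i assume i: "card (spikes E) div 2 < i"
        have "coeff (ballot_poly (card J)) i = 0" if "J \<in> Pow (spikes E)" for J
        proof -
          have "card J \<le> card (spikes E)" using that finite_spikes[OF E] by (auto intro: card_mono)
          then have "\<not> 2 * i \<le> card J" using i by linarith
          then show ?thesis by (simp add: coeff_ballot_poly)
        qed
        then show "coeff (thag_KL E) i = 0"
          unfolding thag_KL_def using True by (simp add: coeff_sum)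
      qed
      then show ?thesis using True by (simp add: rank)
    next
      case False
      then show ?thesis using that by (simp add: thag_KL_def)
    qed
    show "(-1) ^ rank_of (thagomizer n) E * reverse_poly (rank_of (thagomizer n) E) (thag_KL E) =
        (\<Sum>F\<in>{F \<in> flats (thagomizer n). F \<subseteq> E}.
          (-1) ^ rank_of (thagomizer n) F * thag_KL F * flag_poly (thagomizer n) thag_mu F E)"
      unfolding flag_poly_thag_mu using E
    proof (cases rule: flat_thagomizerE)
      case (1 P Q)
      have "rank_of (thagomizer n) E = card E" "thag_KL E = 1"
        using subset_free_thag_set[OF 1(1-3), of E] 1(4) rank by (simp_all add: thag_KL_def)
      then show "(-1) ^ rank_of (thagomizer n) E * reverse_poly (rank_of (thagomizer n) E) (thag_KL E) =
        (\<Sum>F\<in>{F \<in> flats (thagomizer n). F \<subseteq> E}.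
          (-1) ^ rank_of (thagomizer n) F * thag_KL F * mu_sum n [:0, 1:] F E)"
        using thag_KL_eq_free[OF 1] by simp
    next
      case (2 R)
      have "rank_of (thagomizer n) E = Suc (card R)"
        "thag_KL E = (\<Sum>J\<in>Pow R. ballot_poly (card J))"
        using rank 2 by (simp_all add: thag_KL_def)
      then show "(-1) ^ rank_of (thagomizer n) E * reverse_poly (rank_of (thagomizer n) E) (thag_KL E) =
        (\<Sum>F\<in>{F \<in> flats (thagomizer n). F \<subseteq> E}.
          (-1) ^ rank_of (thagomizer n) F * thag_KL F * mu_sum n [:0, 1:] F E)"
        using thag_KL_eq_True[OF 2(1)] 2(2) by simp
    qed
  qed
  then show ?thesis by (simp add: thag_KL_def ground_thagomizer)
qed

section \<open>Log-concavity\<close>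

fun pascal :: "(int \<Rightarrow> int) \<Rightarrow> nat \<Rightarrow> int \<Rightarrow> int" where
  "pascal g 0 s = g s"
| "pascal g (Suc N) s = pascal g N s + pascal g N (s - 1)"

text \<open>For \<open>g x = max 0 (- x)\<close> this is the two-parameter sum
  \<open>S(N, s)\<close> of the overview. Integer positions spare a boundary case in the
  recursion.\<close>

lemma pascal_eq_sum: "pascal g N s = (\<Sum>j\<le>N. int (N choose j) * g (s - int j))"
proof (induction N arbitrary: s)
  case (Suc N)
  let ?h = "\<lambda>j. g (s - int j)"
  have "(\<Sum>j\<le>Suc N. int (Suc N choose j) * ?h j) =
      ?h 0 + (\<Sum>j\<le>N. int (N choose Suc j) * ?h (Suc j)) + (\<Sum>j\<le>N. int (N choose j) * ?h (Suc j))"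
    unfolding sum.atMost_Suc_shift by (simp add: algebra_simps sum.distrib)
  also have "?h 0 + (\<Sum>j\<le>N. int (N choose Suc j) * ?h (Suc j)) =
      (\<Sum>j\<le>Suc N. int (N choose j) * ?h j)"
    unfolding sum.atMost_Suc_shift by simp
  also have "\<dots> = (\<Sum>j\<le>N. int (N choose j) * ?h j)"
    by (simp add: binomial_eq_0)
  finally show ?case
    by (simp add: Suc.IH algebra_simps)
qed simp

text \<open>Asking for all \<open>x \<le> y\<close>, rather than only \<open>x = y\<close>, excludes
  internal zeros and is what the Pascal step needs.\<close>

definition log_concave_seq :: "(int \<Rightarrow> int) \<Rightarrow> bool" where
  "log_concave_seq g \<longleftrightarrow>
     (\<forall>x. 0 \<le> g x) \<and> (\<forall>x y. x \<le> y \<longrightarrow> g (x - 1) * g (y + 1) \<le> g x * g y)"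

lemma log_concave_seqD:
  assumes "log_concave_seq g"
  shows "0 \<le> g x" "x \<le> y \<Longrightarrow> u = x - 1 \<Longrightarrow> v = y + 1 \<Longrightarrow> g u * g v \<le> g x * g y"
  using assms unfolding log_concave_seq_def by auto

text \<open>Expanding both products leaves \<open>h (x - 1) * h y\<close> on both sides; the other
  three products on the left are bounded one by one by those on the right.\<close>

lemma log_concave_seq_pascal: "log_concave_seq g \<Longrightarrow> log_concave_seq (pascal g N)"
proof (induction N)
  case 0
  then show ?case by (simp add: log_concave_seq_def)
next
  case (Suc N)
  define h where "h = pascal g N"
  have h: "log_concave_seq h" using Suc by (simp add: h_def)
  note le = log_concave_seqD(2)[OF h]
  have "(h (x - 1) + h (x - 2)) * (h (y + 1) + h y) \<le> (h x + h (x - 1)) * (h y + h (y - 1))"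
    if "x \<le> y" for x y
  proof -
    have "h (x - 1) * h (y + 1) \<le> h x * h y" using that by (intro le) auto
    moreover have "h (x - 2) * h y \<le> h (x - 1) * h (y - 1)" using that by (intro le) auto
    \<comment> \<open>Both positions move inwards twice; for \<open>x = y\<close> the second move
      only exchanges the factors.\<close>
    moreover have "h (x - 2) * h (y + 1) \<le> h x * h (y - 1)"
    proof -
      have "h (x - 2) * h (y + 1) \<le> h (x - 1) * h y" using that by (intro le) auto
      also have "\<dots> \<le> h x * h (y - 1)"
      proof (cases "x = y")
        case False
        then show ?thesis using that by (intro le) auto
      qed simp
      finally show ?thesis .
    qed
    ultimately show ?thesis by (simp add: algebra_simps)
  qed
  moreover have "pascal g (Suc N) = (\<lambda>s. h s + h (s - 1))" by (auto simp: h_def)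
  ultimately show ?case
    using log_concave_seqD(1)[OF h] unfolding log_concave_seq_def by (simp add: add_nonneg_nonneg)
qed

text \<open>In terms of row \<open>N\<close> the left side is
  \<open>(h (s - 1) + 2 * h (s - 2) + h (s - 3)) * h (s + 1)\<close>. Its three terms are bounded in
  order by the square of \<open>h s\<close>, by \<open>2 * h s * h (s - 1)\<close> and by the square
  of \<open>h (s - 1)\<close>.\<close>

lemma pascal_diagonal_log_concave:
  assumes "log_concave_seq g"
  shows "pascal g (Suc (Suc N)) (s - 1) * pascal g N (s + 1) \<le> (pascal g (Suc N) s)\<^sup>2"
proof -
  define h where "h = pascal g N"
  have h: "log_concave_seq h" using log_concave_seq_pascal[OF assms] by (simp add: h_def)
  note le = log_concave_seqD(2)[OF h]
  have "h (s - 1) * h (s + 1) \<le> h s * h s" by (intro le) auto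
  moreover have "h (s - 2) * h (s + 1) \<le> h (s - 1) * h s" by (intro le) auto
  moreover have "h (s - 3) * h (s + 1) \<le> h (s - 1) * h (s - 1)"
    using le[of "s - 2" s "s - 3" "s + 1"] le[of "s - 1" "s - 1" "s - 2" s] by simp
  moreover have "pascal g (Suc (Suc N)) (s - 1) = h (s - 1) + 2 * h (s - 2) + h (s - 3)"
    "pascal g N (s + 1) = h (s + 1)" "pascal g (Suc N) s = h s + h (s - 1)"
    by (simp_all add: h_def)
  ultimately show ?thesis by (simp add: power2_eq_square algebra_simps)
qed

text \<open>From the indicator of \<open>0\<close>, \<open>pascal\<close> produces the rows of
  binomial coefficients, so their log-concavity is another instance of
  \<open>log_concave_seq_pascal\<close>.\<close>

lemma log_concave_seq_delta: "log_concave_seq (\<lambda>x. of_bool (x = 0))"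
  unfolding log_concave_seq_def by auto

lemma pascal_delta: "pascal (\<lambda>x. of_bool (x = 0)) N (int i) = int (N choose i)"
proof -
  have "pascal (\<lambda>x. of_bool (x = 0)) N (int i) = (\<Sum>j\<le>N. if j = i then int (N choose j) else 0)"
    unfolding pascal_eq_sum by (intro sum.cong) auto
  then show ?thesis by (auto simp: binomial_eq_0)
qed

lemma binomial_log_concave:
  "int (N choose i) * int (N choose (i + 2)) \<le> (int (N choose (i + 1)))\<^sup>2"
proof -
  let ?p = "pascal (\<lambda>x. of_bool (x = 0)) N"
  have "?p (int i) * ?p (int (i + 2)) \<le> ?p (int (i + 1)) * ?p (int (i + 1))"
    by (rule log_concave_seqD(2)[OF log_concave_seq_pascal[OF log_concave_seq_delta]]) auto
  then show ?thesis unfolding pascal_delta power2_eq_square .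
qed

text \<open>Where all factors are positive, \<open>(x - 1) * (y + 1) = x * y + (x - y) - 1\<close>
  is at most \<open>x * y\<close>; for \<open>y \<ge> -1\<close> the left side vanishes.\<close>

lemma log_concave_seq_neg_part: "log_concave_seq (\<lambda>x. max 0 (- x))"
proof -
  have "max 0 (- (x - 1)) * max 0 (- (y + 1)) \<le> max 0 (- x) * max 0 (- y)" if "x \<le> y" for x y :: int
  proof (cases "y < -1")
    case True
    then have "max 0 (- (x - 1)) * max 0 (- (y + 1)) = x * y + (x - y) - 1"
      using that by (simp add: max_def algebra_simps)
    also have "\<dots> \<le> x * y" using that by simp
    finally show ?thesis using True that by (simp add: max_def)
  next
    case False
    then have "max 0 (- (y + 1)) = 0" by simp
    then show ?thesis by simp
  qed
  then show ?thesis unfolding log_concave_seq_def by simp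
qed

section \<open>Closed form of the coefficients\<close>

lemma sum_Pow_card:
  fixes f :: "nat \<Rightarrow> int"
  assumes "finite A"
  shows "(\<Sum>J\<in>Pow A. f (card J)) = (\<Sum>k\<le>card A. int (card A choose k) * f k)"
proof -
  have "(\<Sum>J\<in>Pow A. f (card J)) = (\<Sum>k\<le>card A. \<Sum>J\<in>{J \<in> Pow A. card J = k}. f (card J))"
    using assms by (subst sum.group) (auto intro: card_mono)
  also have "\<dots> = (\<Sum>k\<le>card A. int (card A choose k) * f k)"
    using n_subsets[OF assms] by (intro sum.cong) simp_all
  finally show ?thesis .
qed

text \<open>Multiplied by \<open>k + 1\<close>, the ballot difference becomes
  \<open>(k + 1 choose i) * (k + 1 - 2 * i)\<close>. The factor \<open>n + 1\<close> supplies this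
  \<open>k + 1\<close> by absorption, and regrouping
  \<open>(n + 1 choose (k + 1)) * (k + 1 choose i)\<close> isolates a factor that is independent of
  \<open>k\<close>.\<close>

lemma ballot_binomial_identity:
  assumes "2 * i \<le> k" "k \<le> n"
  shows "int (n + 1) * (int (n choose k) * (int (k choose i) - (if i = 0 then 0 else int (k choose (i - 1))))) =
    int (n + 1 choose i) * (int (n + 1 - i choose (k + 1 - i)) * (int (k + 1) - 2 * int i))"
proof -
  let ?d = "int (k choose i) - (if i = 0 then 0 else int (k choose (i - 1)))"
  have "int (k + 1) * int (k choose i) = int (k + 1 choose i) * (int (k + 1) - int i)"
  proof -
    have "(k + 1 - i) * (k + 1 choose i) = (k + 1) * (k choose i)"
      using binomial_absorb_comp[of "k + 1" i] by simp
    then have "int (k + 1 - i) * int (k + 1 choose i) = int (k + 1) * int (k choose i)"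
      by (metis of_nat_mult)
    moreover have "int (k + 1 - i) = int (k + 1) - int i" using assms by (intro of_nat_diff) auto
    ultimately show ?thesis by (simp only: mult.commute)
  qed
  moreover have "int (k + 1) * (if i = 0 then 0 else int (k choose (i - 1))) = int (k + 1 choose i) * int i"
  proof (cases i)
    case (Suc m)
    have "Suc k * (k choose m) = (Suc k choose Suc m) * Suc m"
      by (rule Suc_times_binomial_eq)
    then have "int (Suc k) * int (k choose m) = int (Suc k choose Suc m) * int (Suc m)"
      by (metis of_nat_mult)
    then show ?thesis using Suc by simp
  qed simp
  ultimately have d: "int (k + 1) * ?d = int (k + 1 choose i) * (int (k + 1) - 2 * int i)"
    by (simp add: algebra_simps)
  have n: "int (n + 1) * int (n choose k) = int (n + 1 choose (k + 1)) * int (k + 1)"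
    using Suc_times_binomial_eq[of n k] by (metis Suc_eq_plus1 of_nat_mult)
  have c: "int (n + 1 choose (k + 1)) * int (k + 1 choose i) =
      int (n + 1 choose i) * int (n + 1 - i choose (k + 1 - i))"
    using choose_mult[of i "k + 1" "n + 1"] assms by (metis add_le_mono1 le_add2 le_trans mult_2 of_nat_mult trans_le_add1)
  have "int (n + 1) * (int (n choose k) * ?d) = int (n + 1 choose (k + 1)) * (int (k + 1) * ?d)"
    by (simp only: n flip: mult.assoc)
  also have "\<dots> = int (n + 1 choose (k + 1)) * int (k + 1 choose i) * (int (k + 1) - 2 * int i)"
    by (simp only: d mult.assoc)
  finally show ?thesis by (simp only: c mult.assoc)
qed

lemma coeff_inverse_KL_thagomizer:
  "coeff (inverse_KL (thagomizer n)) i = (\<Sum>k\<le>n. int (n choose k) * coeff (ballot_poly k) i)"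
  unfolding inverse_KL_thagomizer coeff_sum
  using sum_Pow_card[of "{1..n}" "\<lambda>k. coeff (ballot_poly k) i"] by simp

text \<open>The substitution \<open>j = k + 1 - i\<close> turns \<open>2 * i \<le> k\<close> into
  \<open>i < j\<close>, which is exactly where \<open>max 0 (j - i)\<close> is positive; so the
  smaller \<open>j\<close> can be added freely.\<close>

lemma coeff_inverse_KL_thagomizer_closed:
  assumes "i \<le> n + 1"
  shows "int (n + 1) * coeff (inverse_KL (thagomizer n)) i =
    int (n + 1 choose i) * pascal (\<lambda>x. max 0 (- x)) (n + 1 - i) (int i)"
proof -
  let ?f = "\<lambda>j. int (n + 1 - i choose j) * (int j - int i)"
  have "int (n + 1) * coeff (inverse_KL (thagomizer n)) i =
      (\<Sum>k\<le>n. int (n + 1) * (int (n choose k) * coeff (ballot_poly k) i))"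
    by (simp only: coeff_inverse_KL_thagomizer sum_distrib_left)
  also have "\<dots> = (\<Sum>k\<in>{2 * i..n}. int (n + 1) * (int (n choose k) * coeff (ballot_poly k) i))"
    by (rule sum.mono_neutral_right) (auto simp: coeff_ballot_poly)
  also have "\<dots> = (\<Sum>k\<in>{2 * i..n}. int (n + 1 choose i) * ?f (k + 1 - i))"
  proof (intro sum.cong refl)
    fix k assume "k \<in> {2 * i..n}"
    then have k: "2 * i \<le> k" "k \<le> n" by auto
    then have "int (k + 1 - i) - int i = int (k + 1) - 2 * int i" by (simp add: of_nat_diff)
    then show "int (n + 1) * (int (n choose k) * coeff (ballot_poly k) i) =
        int (n + 1 choose i) * ?f (k + 1 - i)"
      using ballot_binomial_identity[OF k] k by (simp only: coeff_ballot_poly if_True)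
  qed
  also have "\<dots> = (\<Sum>j\<in>{i + 1..n + 1 - i}. int (n + 1 choose i) * ?f j)"
    by (rule sum.reindex_bij_witness[of _ "\<lambda>j. j + i - 1" "\<lambda>k. k + 1 - i"]) auto
  also have "\<dots> = int (n + 1 choose i) * (\<Sum>j\<in>{i + 1..n + 1 - i}. ?f j)"
    by (simp only: sum_distrib_left)
  also have "(\<Sum>j\<in>{i + 1..n + 1 - i}. ?f j) =
      (\<Sum>j\<in>{i + 1..n + 1 - i}. int (n + 1 - i choose j) * max 0 (- (int i - int j)))"
    by (intro sum.cong) auto
  also have "\<dots> = pascal (\<lambda>x. max 0 (- x)) (n + 1 - i) (int i)"
    unfolding pascal_eq_sum by (rule sum.mono_neutral_left) auto
  finally show ?thesis .
qed

section \<open>Log-concavity of the coefficients\<close>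

theorem theorem1p3:
  fixes n :: nat
  assumes "n > 0"
  shows "log_concave (inverse_KL (thagomizer n))"
  unfolding log_concave_def
proof (intro allI impI)
  let ?a = "coeff (inverse_KL (thagomizer n))"
  fix i assume "1 \<le> i \<and> i + 1 \<le> degree (inverse_KL (thagomizer n))"
  then obtain m where m: "i = m + 1" by (metis le_add_diff_inverse2)
  show "?a (i - 1) * ?a (i + 1) \<le> (?a i)\<^sup>2"
  \<comment> \<open>If this fails, coefficient \<open>i + 1\<close> vanishes. If it holds, the
    subtractions on natural numbers below are exact.\<close>
  proof (cases "2 * (i + 1) \<le> n")
    case False
    then have "?a (i + 1) = 0"
      unfolding coeff_inverse_KL_thagomizer by (intro sum.neutral) (auto simp: coeff_ballot_poly)
    then show ?thesis by simp
  next
    case True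
    define C where "C j = int (n + 1 choose j)" for j
    define S where "S j = pascal (\<lambda>x. max 0 (- x)) (n + 1 - j) (int j)" for j
    have a: "int (n + 1) * ?a j = C j * S j" if "j \<le> n + 1" for j
      using coeff_inverse_KL_thagomizer_closed[OF that] by (simp add: C_def S_def)
    have nonneg: "0 \<le> S j" for j
      unfolding S_def
      by (rule log_concave_seqD(1)[OF log_concave_seq_pascal[OF log_concave_seq_neg_part]])
    have C: "C m * C (m + 2) \<le> (C (m + 1))\<^sup>2"
      unfolding C_def by (rule binomial_log_concave)
    \<comment> \<open>With \<open>N = n - m - 1\<close> and \<open>s = m + 1\<close>, the three
      values lie in rows \<open>N + 2\<close>, \<open>N\<close>, \<open>N + 1\<close> at positions
      \<open>s - 1\<close>, \<open>s + 1\<close>, \<open>s\<close>.\<close>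
    have S: "S m * S (m + 2) \<le> (S (m + 1))\<^sup>2"
    proof -
      have "n + 1 - m = Suc (Suc (n - m - 1))" "n + 1 - (m + 1) = Suc (n - m - 1)"
        "n + 1 - (m + 2) = n - m - 1" using True m by auto
      then show ?thesis
        using pascal_diagonal_log_concave[OF log_concave_seq_neg_part, of "n - m - 1" "int (m + 1)"]
        unfolding S_def by (simp add: add.commute)
    qed
    \<comment> \<open>The positive factor \<open>(int (n + 1))\<^sup>2\<close> makes the closed
      forms available, and the factors \<open>C\<close> and \<open>S\<close> are then compared
      separately.\<close>
    have "(int (n + 1))\<^sup>2 * (?a m * ?a (m + 2)) = (int (n + 1) * ?a m) * (int (n + 1) * ?a (m + 2))"
      by (simp add: power2_eq_square algebra_simps)
    also have "\<dots> = (C m * S m) * (C (m + 2) * S (m + 2))"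
      using True m by (subst (1 2) a) auto
    also have "\<dots> = (C m * C (m + 2)) * (S m * S (m + 2))"
      by (simp only: mult_ac)
    also have "\<dots> \<le> (C (m + 1))\<^sup>2 * (S (m + 1))\<^sup>2"
      using C S nonneg by (intro mult_mono) auto
    also have "\<dots> = (int (n + 1) * ?a (m + 1))\<^sup>2"
      using a[of "m + 1"] True m by (simp add: power_mult_distrib)
    also have "\<dots> = (int (n + 1))\<^sup>2 * (?a (m + 1))\<^sup>2"
      by (rule power_mult_distrib)
    finally have "?a m * ?a (m + 2) \<le> (?a (m + 1))\<^sup>2"
      by (rule mult_left_le_imp_le) simp
    then show ?thesis using m by simp
  qed
qed

end
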